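(* Let $G$ be a $d$-regular graph on $n$ nodes and let $G^+$ be its balancing graph with $d^{\circ}\ge 1$ self-loops per node and degree $d^+=d+d^{\circ}$, where $d^{\circ}=\mathcal{O}(d)$. Let $\delta\ge 0$ be a constant and let $A$ be a cumulatively $\delta$-fair balancer run on $G^+$ from an arbitrary initial load vector with initial discrepancy $K$. Then after $\mathcal{O}(\log(Kn)/\mu)$ time steps, $A$ achieves a discrepancy of (i) $\mathcal{O}\big((\delta+1)\, d\, \sqrt{\log n/\mu}\big)$ if $d^+\ge 2d$; (ii) $\mathcal{O}\big((\delta+1)\, d\, \sqrt{n}\big)$ if $d^+\ge 2d$; (iii) $\mathcal{O}\big((\delta+1)\, d\, \log n/\mu\big)$ for arbitrary $d^+\ge d+1$.
   Context: Model: $G=(V,E)$ is a $d$-regular graph on $n$ nodes without multiple edges, viewed as a symmetric directed graph (every node has in- and out-degree $d$). The balancing graph $G^+$ is obtained by adding $d^{\circ}$ self-loops at every node; $d^+=d+d^{\circ}$. For $u\in V$, $E_u$ denotes the original (non-self-loop) edges out of $u$ and $E_u^+$ denotes $E_u$ together with the $d^{\circ}$ self-loops of $u$. There are $m$ indivisible tokens; $x_t(u)\in\mathbb{Z}_{\ge 0}$ is the load of node $u$ at the beginning of synchronous step $t=1,2,\dots$. In step $t$ each node $u$ distributes all its $x_t(u)$ tokens over the edges of $E_u^+$, sending $f_t(e)$ tokens over edge $e$ ("edge $e$ receives $f_t(e)$ tokens"); the load $x_{t+1}(v)$ is the total number of tokens arriving at $v$ (tokens on self-loops return to $u$). $F_t(e)=\sum_{\tau\le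 t} f_\tau(e)$ is the cumulative flow. The discrepancy at time $t$ is $\max_u x_t(u)-\min_u x_t(u)$; $K$ is the discrepancy of $x_1$. $P$ is the transition matrix of the random walk on $G^+$: $P(u,v)=1/d^+$ if $(u,v)\in E$, $P(u,u)=d^{\circ}/d^+$, and $0$ otherwise; $\mu=1-\lambda_2$ where $\lambda_2$ is the second largest eigenvalue of $P$. An algorithm is cumulatively $\delta$-fair if for all $t$ and all $u\in V$: (a) every edge of $E_u^+$ receives at least $\lfloor x_t(u)/d^+\rfloor$ tokens in step $t$; (b) any two original edges $e_1,e_2\in E_u$ satisfy $|F_t(e_1)-F_t(e_2)|\le\delta$. Asymptotic notation hides absolute constants independent of $n,d,\delta,G$ and the initial loads.
   Formalization: In (iii), μ is replaced (in both time and bound) by 1 minus the second largest eigenvalue in absolute value, since the literal (iii) fails on K_{d,d} with d°=1; it agrees with μ if d⁺≥2d. Also μ>0 (G connected) is assumed, as otherwise the time bound is undefined. *)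

theory Defs
  imports Complex_Main "HOL-Library.Multiset" "HOL-Computational_Algebra.Polynomial"
    "Jordan_Normal_Form.Char_Poly"
begin

(* Nodes are the numbers below n, so that n can be quantified inside a formula,
   after the constants hidden by the asymptotic notation. *)
definition regular_graph :: "nat \<Rightarrow> nat \<Rightarrow> (nat \<times> nat) set \<Rightarrow> bool" where
  "regular_graph n d E \<longleftrightarrow>
     n > 0 \<and> E \<subseteq> {..<n} \<times> {..<n} \<and> irrefl E \<and> sym E \<and> (\<forall>u<n. card (E `` {u}) = d)"

(* Orig u v is the original edge (u, v); Loop u i is the i-th self-loop at u. *)
datatype edge = Orig nat nat | Loop nat nat

primrec target :: "edge \<Rightarrow> nat" where
  "target (Orig u v) = v"
| "target (Loop u i) = u"

definition orig_edges :: "(nat \<times> nat) set \<Rightarrow> nat \<Rightarrow> edge set" where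
  "orig_edges E u = {Orig u v | v. (u, v) \<in> E}"

definition all_edges :: "(nat \<times> nat) set \<Rightarrow> nat \<Rightarrow> nat \<Rightarrow> edge set" where
  "all_edges E dl u = orig_edges E u \<union> {Loop u i | i. i < dl}"

(* A run of a balancer on the balancing graph with dl self-loops per node:
   x t u is the load of u at the beginning of step t, and f t e is the number of
   tokens sent over e in step t. Steps are numbered from 1. *)
definition balancing_run ::
  "nat \<Rightarrow> (nat \<times> nat) set \<Rightarrow> nat \<Rightarrow> (nat \<Rightarrow> nat \<Rightarrow> nat) \<Rightarrow> (nat \<Rightarrow> edge \<Rightarrow> nat) \<Rightarrow> bool" where
  "balancing_run n E dl x f \<longleftrightarrow>
     (\<forall>t\<ge>1. (\<forall>u<n. (\<Sum>e\<in>all_edges E dl u. f t e) = x t u) \<and>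
            (\<forall>v<n. x (t + 1) v = (\<Sum>e\<in>{e \<in> (\<Union>u<n. all_edges E dl u). target e = v}. f t e)))"

definition cumulative_flow :: "(nat \<Rightarrow> edge \<Rightarrow> nat) \<Rightarrow> nat \<Rightarrow> edge \<Rightarrow> nat" where
  "cumulative_flow f t e = (\<Sum>\<tau>=1..t. f \<tau> e)"

definition cumulatively_fair ::
  "real \<Rightarrow> nat \<Rightarrow> nat \<Rightarrow> (nat \<times> nat) set \<Rightarrow> nat \<Rightarrow> (nat \<Rightarrow> nat \<Rightarrow> nat) \<Rightarrow> (nat \<Rightarrow> edge \<Rightarrow> nat) \<Rightarrow> bool"
where
  "cumulatively_fair \<delta> n d E dl x f \<longleftrightarrow>
     (\<forall>t\<ge>1. \<forall>u<n.
        (\<forall>e\<in>all_edges E dl u. x t u div (d + dl) \<le> f t e) \<and>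
        (\<forall>e1\<in>orig_edges E u. \<forall>e2\<in>orig_edges E u.
           \<bar>real (cumulative_flow f t e1) - real (cumulative_flow f t e2)\<bar> \<le> \<delta>))"

definition discrepancy :: "nat \<Rightarrow> (nat \<Rightarrow> nat) \<Rightarrow> real" where
  "discrepancy n y = real (Max (y ` {..<n})) - real (Min (y ` {..<n}))"

definition transition_matrix :: "nat \<Rightarrow> nat \<Rightarrow> (nat \<times> nat) set \<Rightarrow> nat \<Rightarrow> real mat" where
  "transition_matrix n d E dl =
     mat n n (\<lambda>(u, v). if (u, v) \<in> E then 1 / real (d + dl)
                       else if u = v then real dl / real (d + dl) else 0)"

(* Eigenvalues counted with algebraic multiplicity; the transition matrix is symmetric,
   so all n of them are real. *)
definition eigenvalues_mset :: "real mat \<Rightarrow> real multiset" where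
  "eigenvalues_mset A = proots (char_poly A)"

definition second_largest :: "real multiset \<Rightarrow> real" where
  "second_largest M = rev (sorted_list_of_multiset M) ! 1"

definition gap :: "nat \<Rightarrow> nat \<Rightarrow> (nat \<times> nat) set \<Rightarrow> nat \<Rightarrow> real" where
  "gap n d E dl = 1 - second_largest (eigenvalues_mset (transition_matrix n d E dl))"

(* The gap to the eigenvalue that is second largest in absolute value. It equals gap if
   dl \<ge> d, since then no eigenvalue is negative. For dl < d the bound d log n / \<mu> fails with
   gap for \<mu>: on the complete bipartite graph with sides of size d and dl = 1, let one
   side have load (q + d) * (d + 1) and the other q * (d + 1) + d, and let every original
   edge always receive the rounded-down share. The sides then swap their loads in each step,
   so the discrepancy is d^2 forever, although \<delta> = 0 and gap = d / (d + 1). *)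
definition abs_gap :: "nat \<Rightarrow> nat \<Rightarrow> (nat \<times> nat) set \<Rightarrow> nat \<Rightarrow> real" where
  "abs_gap n d E dl =
     1 - second_largest (image_mset abs (eigenvalues_mset (transition_matrix n d E dl)))"

end

theory Submission
  imports Defs "Jordan_Normal_Form.Schur_Decomposition"
begin

text \<open>
  Let \<open>P\<close> be the transition matrix, \<open>g\<^sub>t(u)\<close> the average number of tokens that \<open>u\<close> sends over an
  original edge in step \<open>t\<close>, and \<open>r\<^sub>t = x\<^sub>t - d\<^sup>+ g\<^sub>t\<close>. Condition (a) gives \<open>|r\<^sub>t| = O(d)\<close>, and
  condition (b) says that the cumulative flow over an edge differs from the sum of the averages by at
  most \<open>\<delta>\<close>, so that \<open>x\<^sub>t\<^sub>+\<^sub>1 = P x\<^sub>t + (I - P) r\<^sub>t + \<psi>\<^sub>t - \<psi>\<^sub>t\<^sub>-\<^sub>1\<close> with \<open>|\<psi>\<^sub>t| \<le> \<delta> d\<close>. Solving the recurrence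
  and summing by parts gives \<open>x\<^sub>t\<^sub>+\<^sub>1 = P\<^sup>t x\<^sub>1 + \<psi>\<^sub>t + \<Sum>\<^sub>k P\<^sup>k (I - P) w\<^sub>t\<^sub>-\<^sub>k\<close> with \<open>|w| = O((\<delta> + 1) d)\<close>.
  The first term is balanced after \<open>ln (K n) / \<mu>\<close> steps, and everything reduces to bounding the sum
  over \<open>k\<close> of the absolute row sums \<open>D\<^sub>k\<close> of \<open>P\<^sup>k (I - P)\<close>.

  The spectral gap halves \<open>D\<^sub>k\<close> every \<open>T = O(ln n / \<mu>)\<close> steps, so only \<open>k < T\<close> matters. The trivial
  bound \<open>D\<^sub>k \<le> 2\<close> gives (iii). If \<open>d\<^sup>+ \<ge> 2 d\<close>, then \<open>P = (I + Q) / 2\<close> with \<open>Q\<close> stochastic, and expanding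
  binomially gives \<open>D\<^sub>k \<le> 1 / sqrt (k + 1)\<close>, hence (i). For (ii), the return probabilities minus
  \<open>1 / n\<close> are completely monotone in \<open>k\<close> and have sum \<open>O(n)\<close>, because the Dirichlet energy of the Green
  function is controlled along a shortest path, which has length at most \<open>3 n / d\<close>. Their second
  differences are therefore \<open>O(n / k\<^sup>3)\<close>, so \<open>D\<^sub>k = O(n / (k sqrt k))\<close>, which is used for \<open>k > n\<close>.
\<close>

section \<open>Orthogonal diagonalization of real symmetric matrices\<close>

lemma conjugate_real_vec [simp]: "conjugate (v :: real vec) = v"
  by (rule eq_vecI) auto

text \<open>Gram-Schmidt on a basis starting with \<open>v\<close> leaves the first vector
  unchanged. It only yields orthogonality, so each vector is then scaled to unit length; hence the
  factor \<open>k\<close>.\<close>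

lemma orthonormal_completion:
  fixes v :: "real vec"
  assumes v: "v \<in> carrier_vec n" and v0: "v \<noteq> 0\<^sub>v n"
  obtains W k where "W \<in> carrier_mat n n" "W\<^sup>T * W = 1\<^sub>m n" "col W 0 = k \<cdot>\<^sub>v v"
proof -
  interpret cof_vec_space n "TYPE(real)" .
  have n: "n \<noteq> 0" using v v0 by auto
  define b where "b = basis_completion v"
  define ws where "ws = gram_schmidt n b"
  from basis_completion[OF v v0, folded b_def]
  have dist_b: "distinct b" and indep: "\<not> lin_dep (set b)" and b: "set b \<subseteq> carrier_vec n"
    and hdb: "hd b = v" and len_b: "length b = n" by auto
  from hdb len_b n obtain vs where bv: "b = v # vs" by (cases b) auto
  from gram_schmidt_result[OF b dist_b indep refl, folded ws_def]
  have ws: "set ws \<subseteq> carrier_vec n" "corthogonal ws" "length ws = n"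
    by (auto simp: len_b)
  from gram_schmidt_hd[OF v, of vs, folded bv] have hdws: "hd ws = v" unfolding ws_def .
  define k where "k w = 1 / sqrt (w \<bullet> w)" for w :: "real vec"
  define W where "W = mat_of_cols n (map (\<lambda>w. k w \<cdot>\<^sub>v w) ws)"
  have W: "W \<in> carrier_mat n n" unfolding W_def using ws by auto
  have wsi: "ws ! i \<in> carrier_vec n" if "i < n" for i using ws that by auto
  have colW: "col W i = k (ws ! i) \<cdot>\<^sub>v ws ! i" if "i < n" for i
    unfolding W_def using that ws wsi[OF that] by (subst col_mat_of_cols) auto
  have orth: "ws ! i \<bullet> ws ! j = 0 \<longleftrightarrow> i \<noteq> j" if "i < n" "j < n" for i j
    using corthogonalD[OF ws(2), of i j] that ws(3) by simp
  have pos: "ws ! i \<bullet> ws ! i > 0" if "i < n" for i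
  proof -
    have "ws ! i \<bullet> ws ! i \<ge> 0"
      unfolding scalar_prod_def by (auto intro!: sum_nonneg)
    then show ?thesis using orth[OF that that] by simp
  qed
  have "W\<^sup>T * W = 1\<^sub>m n"
  proof (rule eq_matI)
    fix i j assume "i < dim_row (1\<^sub>m n :: real mat)" "j < dim_col (1\<^sub>m n :: real mat)"
    then have ij: "i < n" "j < n" by auto
    have "(W\<^sup>T * W) $$ (i, j) = col W i \<bullet> col W j" using ij W by auto
    also have "\<dots> = k (ws ! i) * (k (ws ! j) * (ws ! i \<bullet> ws ! j))"
      using ij wsi
      by (simp add: colW smult_scalar_prod_distrib[of _ n] scalar_prod_smult_distrib[of _ n])
    also have "\<dots> = (if i = j then 1 else 0)"
      using orth[OF ij] pos[OF ij(1)] by (auto simp: k_def field_simps)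
    finally show "(W\<^sup>T * W) $$ (i, j) = 1\<^sub>m n $$ (i, j)" using ij by auto
  qed (use W in auto)
  moreover have "col W 0 = k v \<cdot>\<^sub>v v"
    using colW[of 0] n hdws ws(3) by (cases ws) auto
  ultimately show ?thesis using that W by blast
qed

text \<open>Deflation, by induction on the list of roots: in an orthonormal basis starting with an
  eigenvector for the first root, a 1 by 1 block splits off, and the remaining block is again
  symmetric. The list \<open>es\<close> ties the diagonal to the roots with multiplicity.\<close>

lemma symmetric_diagonalization:
  fixes A :: "real mat"
  assumes "A \<in> carrier_mat n n" "A\<^sup>T = A" "char_poly A = (\<Prod>e\<leftarrow>es. [:- e, 1:])"
  shows "\<exists>U \<in> carrier_mat n n. U\<^sup>T * U = 1\<^sub>m n \<and> U\<^sup>T * A * U = mat_diag n (\<lambda>i. es ! i)"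
  using assms
proof (induction es arbitrary: n A)
  case Nil
  then have "n = 0" using degree_monic_char_poly[of A n] by auto
  then show ?case using Nil by (intro bexI[of _ "1\<^sub>m n"]) (auto simp: mat_diag_def)
next
  case (Cons e es)
  note A = Cons.prems(1)
  have cp: "char_poly A = [:- e, 1:] * (\<Prod>e\<leftarrow>es. [:- e, 1:])" using Cons.prems(3) by auto
  then have e: "eigenvalue A e" unfolding eigenvalue_root_char_poly[OF A] by simp
  then obtain v where ev: "eigenvector A v e" unfolding eigenvalue_def by auto
  then have v: "v \<in> carrier_vec n" and v0: "v \<noteq> 0\<^sub>v n" and Av: "A *\<^sub>v v = e \<cdot>\<^sub>v v"
    using A unfolding eigenvector_def by auto
  have n0: "n \<noteq> 0" using v v0 by auto
  define m where "m = n - 1"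
  have n: "n = 1 + m" using n0 by (simp add: m_def)
  obtain W k where W: "W \<in> carrier_mat n n" and WW: "W\<^sup>T * W = 1\<^sub>m n" and W0: "col W 0 = k \<cdot>\<^sub>v v"
    using orthonormal_completion[OF v v0] by blast
  have WT: "W\<^sup>T \<in> carrier_mat n n" using W by auto
  have WW': "W * W\<^sup>T = 1\<^sub>m n" using mat_mult_left_right_inverse[OF WT W WW] .
  define B where "B = W\<^sup>T * A * W"
  have B: "B \<in> carrier_mat n n" using A W unfolding B_def by auto
  have Bsym: "B\<^sup>T = B"
    unfolding B_def using A W WT Cons.prems(2)
    by (simp add: transpose_mult[of _ n n _ n] assoc_mult_mat[of _ n n _ n _ n])
  have B0: "B $$ (i, 0) = (if i = 0 then e else 0)" if i: "i < n" for i
  proof -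
    have AW0: "col (A * W) 0 = e \<cdot>\<^sub>v col W 0"
    proof -
      have "col (A * W) 0 = A *\<^sub>v col W 0" using A W n0 by (intro col_mult2) auto
      also have "\<dots> = k \<cdot>\<^sub>v (A *\<^sub>v v)" unfolding W0 by (rule mult_mat_vec[OF A v])
      finally show ?thesis unfolding Av W0 smult_smult_assoc by (simp only: mult.commute)
    qed
    have "B = W\<^sup>T * (A * W)" unfolding B_def using A W WT by (simp add: assoc_mult_mat[of _ n n _ n _ n])
    then have "B $$ (i, 0) = row (W\<^sup>T) i \<bullet> col (A * W) 0"
      using i n0 A W by simp
    also have "\<dots> = e * (row (W\<^sup>T) i \<bullet> col W 0)"
      unfolding AW0 using W n0 i by (intro scalar_prod_smult_distrib[of _ n]) auto
    also have "row (W\<^sup>T) i \<bullet> col W 0 = (W\<^sup>T * W) $$ (i, 0)" using W n0 i by simp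
    finally show ?thesis unfolding WW using i n0 by auto
  qed
  define A3 where "A3 = mat m m (\<lambda>(i, j). B $$ (Suc i, Suc j))"
  have A3: "A3 \<in> carrier_mat m m" unfolding A3_def by auto
  have Bsym': "B $$ (i, j) = B $$ (j, i)" if "i < n" "j < n" for i j
    using arg_cong[OF Bsym, of "\<lambda>X. X $$ (i, j)"] that B by simp
  have A3sym: "A3\<^sup>T = A3"
    by (rule eq_matI) (auto simp: A3_def n intro!: Bsym')
  define E1 where "E1 = mat 1 1 (\<lambda>_. e)"
  have E1: "E1 \<in> carrier_mat 1 1" unfolding E1_def by auto
  \<comment> \<open>The first column is \<open>e\<close> times the first unit vector, and by
    symmetry so is the first row.\<close>
  have Bblock: "B = four_block_mat E1 (0\<^sub>m 1 m) (0\<^sub>m m 1) A3"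
    using B B0 Bsym'[of 0] unfolding n
    by (intro eq_matI) (auto simp: E1_def A3_def)
  have "similar_mat B A"
    unfolding similar_mat_def
    by (intro exI, rule similar_mat_witI[of "W\<^sup>T" W n B A]) (use WW WW' A B W WT in \<open>auto simp: B_def\<close>)
  then have "char_poly A = char_poly E1 * char_poly A3"
    unfolding Bblock using char_poly_similar char_poly_four_block_zeros_col[OF E1 _ A3, of "0\<^sub>m 1 m"] by force
  also have "char_poly E1 = [:- e, 1:]"
    by (simp add: E1_def char_poly_defs det_def sign_def)
  finally have "char_poly A3 = (\<Prod>e\<leftarrow>es. [:- e, 1:])"
    unfolding cp by (metis mult_cancel_left pCons_eq_0_iff zero_neq_one)
  from Cons.IH[OF A3 A3sym this] obtain V where V: "V \<in> carrier_mat m m"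
    and VV: "V\<^sup>T * V = 1\<^sub>m m" and VA: "V\<^sup>T * A3 * V = mat_diag m (\<lambda>i. es ! i)" by blast
  define X where "X = four_block_mat (1\<^sub>m 1) (0\<^sub>m 1 m) (0\<^sub>m m 1) V"
  have X: "X \<in> carrier_mat n n" unfolding X_def n using V by auto
  have XT: "X\<^sup>T = four_block_mat (1\<^sub>m 1) (0\<^sub>m 1 m) (0\<^sub>m m 1) (V\<^sup>T)"
    unfolding X_def by (subst transpose_four_block_mat[of _ 1 1 _ m _ m]) (use V in auto)
  have XX: "X\<^sup>T * X = 1\<^sub>m n"
    unfolding XT unfolding X_def n using V VV
    by (subst mult_four_block_mat[of _ 1 1 _ m _ m _ _ 1 _ m]) auto
  have "X\<^sup>T * B = four_block_mat E1 (0\<^sub>m 1 m) (0\<^sub>m m 1) (V\<^sup>T * A3)"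
    unfolding XT Bblock using V E1 A3
    by (subst mult_four_block_mat[of _ 1 1 _ m _ m _ _ 1 _ m]) auto
  then have "X\<^sup>T * B * X = four_block_mat E1 (0\<^sub>m 1 m) (0\<^sub>m m 1) (V\<^sup>T * A3 * V)"
    unfolding X_def using V E1 A3
    by (auto simp: mult_four_block_mat[of _ 1 1 _ m _ m _ _ 1 _ m])
  also have "\<dots> = mat_diag n (\<lambda>i. (e # es) ! i)"
    unfolding VA n by (rule eq_matI) (auto simp: mat_diag_def E1_def nth_Cons')
  finally have XBX: "X\<^sup>T * B * X = mat_diag n (\<lambda>i. (e # es) ! i)" .
  have XT': "X\<^sup>T \<in> carrier_mat n n" using X by auto
  have trans: "(W * X)\<^sup>T = X\<^sup>T * W\<^sup>T" using transpose_mult[OF W X] .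
  have "(W * X)\<^sup>T * (W * X) = X\<^sup>T * (W\<^sup>T * W) * X"
    unfolding trans using W WT X XT' by (simp add: assoc_mult_mat[of _ n n _ n _ n])
  then have 1: "(W * X)\<^sup>T * (W * X) = 1\<^sub>m n" using XX XT' by (simp add: WW)
  have "(W * X)\<^sup>T * A * (W * X) = X\<^sup>T * B * X"
    unfolding trans B_def using W WT X XT' A by (simp add: assoc_mult_mat[of _ n n _ n _ n])
  with 1 show ?case using XBX W X by (intro bexI[of _ "W * X"]) auto
qed

text \<open>The factorization is taken over the complex numbers and brought back once all roots are
  known to be real.\<close>

lemma symmetric_char_poly_splits:
  fixes A :: "real mat"
  assumes A: "A \<in> carrier_mat n n" and sym: "A\<^sup>T = A"
  obtains es where "char_poly A = (\<Prod>e\<leftarrow>es. [:- e, 1:])" "length es = n"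
proof -
  define C where "C = map_mat complex_of_real A"
  have C: "C \<in> carrier_mat n n" using A by (simp add: C_def)
  obtain as where as: "char_poly C = (\<Prod>a\<leftarrow>as. [:- a, 1:])" "length as = n"
    using char_poly_factorized[OF C] by blast
  have real: "a \<in> \<real>" if "a \<in> set as" for a
  proof -
    have "poly (char_poly C) a = 0" unfolding as using that by (rule linear_poly_root)
    then have "eigenvalue C a" using eigenvalue_root_char_poly[OF C] by simp
    then obtain v where v: "v \<in> carrier_vec n" "v \<noteq> 0\<^sub>v n" "C *\<^sub>v v = a \<cdot>\<^sub>v v"
      using C unfolding eigenvalue_def eigenvector_def by auto
    have Asym: "A $$ (i, j) = A $$ (j, i)" if "i < n" "j < n" for i j
      using arg_cong[OF sym, of "\<lambda>X. X $$ (i, j)"] that A by simp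
    have row: "(\<Sum>j<n. complex_of_real (A $$ (i, j)) * v $ j) = a * v $ i" if "i < n" for i
      using arg_cong[OF v(3), of "\<lambda>w. w $ i"] that A v(1)
      by (simp add: C_def scalar_prod_def lessThan_atLeast0)
    \<comment> \<open>The Hermitian form at the eigenvector: it equals \<open>a\<close> times the
      squared norm \<open>N\<close>, and symmetry of \<open>A\<close> makes it its own
      conjugate.\<close>
    define S where "S = (\<Sum>i<n. \<Sum>j<n. complex_of_real (A $$ (i, j)) * v $ j * cnj (v $ i))"
    define N where "N = (\<Sum>i<n. (cmod (v $ i))\<^sup>2)"
    have "S = (\<Sum>i<n. (\<Sum>j<n. complex_of_real (A $$ (i, j)) * v $ j) * cnj (v $ i))"
      unfolding S_def by (simp add: sum_distrib_right)
    also have "\<dots> = (\<Sum>i<n. a * v $ i * cnj (v $ i))" using row by simp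
    also have "\<dots> = a * complex_of_real N"
      unfolding N_def by (simp add: sum_distrib_left complex_norm_square mult.assoc del: of_real_power)
    finally have SN: "S = a * complex_of_real N" .
    have "cnj S = (\<Sum>i<n. \<Sum>j<n. complex_of_real (A $$ (i, j)) * v $ i * cnj (v $ j))"
      unfolding S_def by (simp add: mult.assoc mult.left_commute mult.commute)
    also have "\<dots> = (\<Sum>j<n. \<Sum>i<n. complex_of_real (A $$ (i, j)) * v $ i * cnj (v $ j))"
      by (rule sum.swap)
    also have "\<dots> = S" unfolding S_def by (intro sum.cong refl) (simp add: Asym)
    finally have "S \<in> \<real>" using Reals_cnj_iff by blast
    moreover have "N > 0"
    proof -
      obtain i where i: "i < n" "v $ i \<noteq> 0" using v(1,2) by (metis carrier_vecD eq_vecI index_zero_vec)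
      then show ?thesis unfolding N_def by (intro sum_pos2[of _ i]) auto
    qed
    ultimately show ?thesis unfolding SN using Reals_divide[of "a * complex_of_real N" "complex_of_real N"]
      by (metis Reals_of_real less_irrefl nonzero_mult_div_cancel_right of_real_eq_0_iff)
  qed
  define es where "es = map Re as"
  have as_es: "as = map complex_of_real es"
    unfolding es_def using real by (auto simp: o_def intro!: map_idI[symmetric])
  interpret hp: map_poly_inj_idom_hom complex_of_real ..
  have "map_poly complex_of_real (char_poly A) = char_poly C"
    unfolding C_def by (rule of_real_hom.char_poly_hom[OF A, symmetric])
  also have "\<dots> = map_poly complex_of_real (\<Prod>e\<leftarrow>es. [:- e, 1:])"
    unfolding as as_es by (simp add: hp.hom_prod_list o_def)
  finally have "char_poly A = (\<Prod>e\<leftarrow>es. [:- e, 1:])" by (rule hp.injectivity)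
  moreover have "length es = n" using as(2) by (simp add: es_def)
  ultimately show ?thesis by (rule that)
qed

lemma proots_linear_factors: "proots (\<Prod>e\<leftarrow>es. [:- e, 1:]) = mset (es :: real list)"
proof (induction es)
  case (Cons e es)
  have "(\<Prod>e\<leftarrow>es. [:- e, 1:]) \<noteq> 0" by (auto simp: prod_list_zero_iff)
  then show ?case using Cons by (simp add: proots_mult del: mult_pCons_left)
qed simp

text \<open>The diagonalization in terms of functions and sums. The last conjunct is completeness of
  the basis; it comes from \<open>U * U\<^sup>T = 1\<^sub>m n\<close> and later yields Parseval's
  identity.\<close>

lemma symmetric_eigenbasis:
  fixes p :: "nat \<Rightarrow> nat \<Rightarrow> real"
  assumes sym: "\<And>u v. u < n \<Longrightarrow> v < n \<Longrightarrow> p u v = p v u"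
  shows "\<exists>e w.
    eigenvalues_mset (mat n n (\<lambda>(u, v). p u v)) = image_mset e (mset_set {..<n}) \<and>
    (\<forall>i u. i < n \<longrightarrow> u < n \<longrightarrow> (\<Sum>v<n. p u v * w i v) = e i * w i u) \<and>
    (\<forall>i j. i < n \<longrightarrow> j < n \<longrightarrow> (\<Sum>u<n. w i u * w j u) = (if i = j then 1 else 0)) \<and>
    (\<forall>u v. u < n \<longrightarrow> v < n \<longrightarrow> (\<Sum>i<n. w i u * w i v) = (if u = v then 1 else 0))"
proof -
  define A where "A = mat n n (\<lambda>(u, v). p u v)"
  have A: "A \<in> carrier_mat n n" unfolding A_def by auto
  have At: "A\<^sup>T = A" by (rule eq_matI) (auto simp: A_def sym)
  obtain es where es: "char_poly A = (\<Prod>e\<leftarrow>es. [:- e, 1:])" "length es = n"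
    using symmetric_char_poly_splits[OF A At] by blast
  obtain U where U: "U \<in> carrier_mat n n" and UU: "U\<^sup>T * U = 1\<^sub>m n"
    and UA: "U\<^sup>T * A * U = mat_diag n (\<lambda>i. es ! i)"
    using symmetric_diagonalization[OF A At es(1)] by blast
  have UT: "U\<^sup>T \<in> carrier_mat n n" using U by auto
  have UU': "U * U\<^sup>T = 1\<^sub>m n" using mat_mult_left_right_inverse[OF UT U UU] .
  have "A * U = (U * U\<^sup>T) * (A * U)" unfolding UU' using A U by simp
  also have "\<dots> = U * (U\<^sup>T * A * U)" using A U UT by (simp add: assoc_mult_mat[of _ n n _ n _ n])
  also have "\<dots> = mat n n (\<lambda>(i, j). U $$ (i, j) * es ! j)"
    unfolding UA by (rule mat_diag_mult_right[OF U])
  finally have AU: "A * U = mat n n (\<lambda>(i, j). U $$ (i, j) * es ! j)" .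
  show ?thesis
  proof (intro exI[of _ "\<lambda>i. es ! i"] exI[of _ "\<lambda>i u. U $$ (u, i)"] conjI allI impI)
    have "image_mset ((!) es) (mset_set {..<n}) = mset (map ((!) es) [0..<n])"
      by (simp add: lessThan_atLeast0 mset_map)
    also have "map ((!) es) [0..<n] = es" using es(2) map_nth by metis
    finally show "eigenvalues_mset (mat n n (\<lambda>(u, v). p u v)) = image_mset ((!) es) (mset_set {..<n})"
      unfolding A_def[symmetric] eigenvalues_mset_def es(1) proots_linear_factors by simp
  next
    fix i u assume "i < n" "u < n"
    then show "(\<Sum>v<n. p u v * U $$ (v, i)) = es ! i * U $$ (u, i)"
      using arg_cong[OF AU, of "\<lambda>X. X $$ (u, i)"] U A
      by (simp add: A_def scalar_prod_def lessThan_atLeast0 mult.commute)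
  next
    fix i j assume "i < n" "j < n"
    then show "(\<Sum>u<n. U $$ (u, i) * U $$ (u, j)) = (if i = j then 1 else 0)"
      using arg_cong[OF UU, of "\<lambda>X. X $$ (i, j)"] U
      by (simp add: scalar_prod_def lessThan_atLeast0)
  next
    fix u v assume "u < n" "v < n"
    then show "(\<Sum>i<n. U $$ (u, i) * U $$ (v, i)) = (if u = v then 1 else 0)"
      using arg_cong[OF UU', of "\<lambda>X. X $$ (u, v)"] U
      by (simp add: scalar_prod_def lessThan_atLeast0)
  qed
qed

section \<open>Sums and sequences\<close>

text \<open>Lagrange's identity: the double sum of the squares of
  \<open>a i * b j - a j * b i\<close> is twice the difference of the two sides.\<close>

lemma sum_Cauchy_Schwarz:
  fixes a b :: "'a \<Rightarrow> real"
  shows "(\<Sum>i\<in>I. a i * b i)\<^sup>2 \<le> (\<Sum>i\<in>I. (a i)\<^sup>2) * (\<Sum>i\<in>I. (b i)\<^sup>2)"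
proof -
  have "0 \<le> (\<Sum>i\<in>I. \<Sum>j\<in>I. (a i * b j - a j * b i)\<^sup>2)" by (intro sum_nonneg) auto
  also have "\<dots> = (\<Sum>i\<in>I. \<Sum>j\<in>I. (a i)\<^sup>2 * (b j)\<^sup>2) + (\<Sum>i\<in>I. \<Sum>j\<in>I. (b i)\<^sup>2 * (a j)\<^sup>2)
      - 2 * (\<Sum>i\<in>I. \<Sum>j\<in>I. (a i * b i) * (a j * b j))"
    unfolding sum_distrib_left sum.distrib[symmetric] sum_subtractf[symmetric]
    by (intro sum.cong refl) (simp add: power2_eq_square algebra_simps)
  also have "\<dots> = 2 * ((\<Sum>i\<in>I. (a i)\<^sup>2) * (\<Sum>i\<in>I. (b i)\<^sup>2)) - 2 * (\<Sum>i\<in>I. a i * b i)\<^sup>2"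
    by (simp add: sum_product[symmetric] power2_eq_square)
  finally show ?thesis by simp
qed

lemma sum_binomial_Suc:
  fixes a :: "nat \<Rightarrow> real"
  shows "(\<Sum>j\<le>Suc k. real (Suc k choose j) * a j) = (\<Sum>j\<le>k. real (k choose j) * (a j + a (Suc j)))"
proof -
  have "(\<Sum>j\<le>Suc k. real (k choose j) * a j) = a 0 + (\<Sum>j\<le>k. real (k choose Suc j) * a (Suc j))"
    by (subst sum.atMost_Suc_shift) simp
  then have "(\<Sum>j\<le>k. real (k choose j) * a j) = a 0 + (\<Sum>j\<le>k. real (k choose Suc j) * a (Suc j))"
    by (simp add: binomial_eq_0)
  then show ?thesis
    by (subst sum.atMost_Suc_shift) (simp add: algebra_simps sum.distrib)
qed

text \<open>Multiplied by \<open>Suc k\<close>, the coefficients of \<open>a j\<close> in the two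
  halves become \<open>Suc k choose j\<close> times \<open>Suc k - j\<close> and times
  \<open>j\<close>. A binomial average of differences thus turns into a sum weighted by the
  deviation from the binomial mean.\<close>

lemma sum_binomial_difference:
  fixes a :: "nat \<Rightarrow> real"
  shows "(\<Sum>j\<le>k. real (k choose j) * (a j - a (Suc j)))
       = (\<Sum>j\<le>Suc k. real (Suc k choose j) * (real (Suc k) - 2 * real j) * a j) / real (Suc k)"
proof -
  have 1: "real (Suc k) * real (k choose j) = real (Suc k choose j) * (real (Suc k) - real j)" if "j \<le> k" for j
  proof -
    have "(Suc k - j) * (Suc k choose j) = Suc k * (k choose j)"
      using binomial_absorb_comp[of "Suc k" j] by simp
    then show ?thesis using that by (metis Suc_leI le_imp_less_Suc less_imp_le mult.commute of_nat_diff of_nat_mult)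
  qed
  have 2: "real (Suc k) * real (k choose j) = real (Suc k choose Suc j) * real (Suc j)" for j
    using Suc_times_binomial[of j k] by (metis mult.commute of_nat_mult)
  have "real (Suc k) * (\<Sum>j\<le>k. real (k choose j) * (a j - a (Suc j)))
      = (\<Sum>j\<le>k. (real (Suc k) * real (k choose j)) * a j) - (\<Sum>j\<le>k. (real (Suc k) * real (k choose j)) * a (Suc j))"
    by (simp only: sum_distrib_left sum_subtractf[symmetric]) (simp add: algebra_simps)
  also have "(\<Sum>j\<le>k. (real (Suc k) * real (k choose j)) * a j)
      = (\<Sum>j\<le>k. real (Suc k choose j) * (real (Suc k) - real j) * a j)"
    by (intro sum.cong refl) (use 1 in auto)
  also have "\<dots> = (\<Sum>j\<le>Suc k. real (Suc k choose j) * (real (Suc k) - real j) * a j)" by simp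
  also have "(\<Sum>j\<le>k. (real (Suc k) * real (k choose j)) * a (Suc j))
      = (\<Sum>j\<le>Suc k. real (Suc k choose j) * real j * a j)"
    by (subst sum.atMost_Suc_shift) (unfold 2, simp)
  finally have "real (Suc k) * (\<Sum>j\<le>k. real (k choose j) * (a j - a (Suc j)))
      = (\<Sum>j\<le>Suc k. real (Suc k choose j) * (real (Suc k) - 2 * real j) * a j)"
    by (simp only: sum_subtractf[symmetric]) (simp add: algebra_simps)
  then show ?thesis by (simp add: field_simps)
qed

lemma binomial_row_sum: "(\<Sum>j\<le>m. real (m choose j)) = 2 ^ m"
  using choose_row_sum[of m] by (metis of_nat_numeral of_nat_power of_nat_sum)

text \<open>\<open>m - 2 * j\<close> is the endpoint of a simple random walk with \<open>j\<close>
  of its \<open>m\<close> steps going down. After Pascal's rule the induction step is (s + 1)^2 + (s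
  - 1)^2 = 2 s^2 + 2.\<close>

lemma binomial_variance: "(\<Sum>j\<le>m. real (m choose j) * (real m - 2 * real j)\<^sup>2) = real m * 2 ^ m"
proof (induction m)
  case (Suc m)
  have "(\<Sum>j\<le>Suc m. real (Suc m choose j) * (real (Suc m) - 2 * real j)\<^sup>2)
      = (\<Sum>j\<le>m. 2 * (real (m choose j) * (real m - 2 * real j)\<^sup>2) + 2 * real (m choose j))"
    by (subst sum_binomial_Suc) (intro sum.cong refl, simp add: power2_eq_square algebra_simps)
  also have "\<dots> = real (Suc m) * 2 ^ Suc m"
    unfolding sum.distrib sum_distrib_left[symmetric] Suc binomial_row_sum by (simp add: algebra_simps)
  finally show ?case .
qed simp

text \<open>The mean absolute deviation is at most the standard deviation: Cauchy-Schwarz with each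
  binomial weight split into two square roots.\<close>

lemma binomial_mean_deviation:
  "(\<Sum>j\<le>m. real (m choose j) * \<bar>real m - 2 * real j\<bar>) \<le> 2 ^ m * sqrt (real m)"
proof (rule power2_le_imp_le)
  have "(\<Sum>j\<le>m. real (m choose j) * \<bar>real m - 2 * real j\<bar>)\<^sup>2
      = (\<Sum>j\<le>m. sqrt (real (m choose j)) * (sqrt (real (m choose j)) * \<bar>real m - 2 * real j\<bar>))\<^sup>2"
    by (simp add: mult.assoc[symmetric])
  also have "\<dots> \<le> (\<Sum>j\<le>m. (sqrt (real (m choose j)))\<^sup>2)
      * (\<Sum>j\<le>m. (sqrt (real (m choose j)) * \<bar>real m - 2 * real j\<bar>)\<^sup>2)"
    by (rule sum_Cauchy_Schwarz)
  also have "\<dots> = (2 ^ m * sqrt (real m))\<^sup>2"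
    by (simp add: power_mult_distrib binomial_row_sum binomial_variance) (simp add: power2_eq_square)
  finally show "(\<Sum>j\<le>m. real (m choose j) * \<bar>real m - 2 * real j\<bar>)\<^sup>2 \<le> (2 ^ m * sqrt (real m))\<^sup>2" .
qed simp

lemma antimono_mult_le_sum:
  fixes a :: "nat \<Rightarrow> real"
  assumes "\<And>j. a (Suc j) \<le> a j"
  shows "real m * a (i + m) \<le> (\<Sum>j<m. a (i + j))"
proof -
  have "a (i + m) \<le> a (i + j)" if "j < m" for j
    using lift_Suc_antimono_le[of a "i + j" "i + m"] assms that by simp
  then have "(\<Sum>j<m. a (i + m)) \<le> (\<Sum>j<m. a (i + j))" by (intro sum_mono) auto
  then show ?thesis by simp
qed

text \<open>A decreasing sequence is bounded by its average over a preceding block of length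
  \<open>m\<close>. Three consecutive blocks are used: the sum bounds \<open>a m\<close>, this
  bounds \<open>b (2 * m)\<close>, and this bounds \<open>c (3 * m)\<close>, with a factor
  \<open>m\<close> gained each time.\<close>

lemma second_difference_decay:
  fixes a b c :: "nat \<Rightarrow> real"
  assumes b: "\<And>j. b j = a j - a (Suc j)" and c: "\<And>j. c j = b j - b (Suc j)"
    and nonneg: "\<And>j. a j \<ge> 0" "\<And>j. b j \<ge> 0" "\<And>j. c j \<ge> 0"
    and decr: "\<And>j. c (Suc j) \<le> c j"
    and sum: "\<And>N. (\<Sum>j<N. a j) \<le> R"
  shows "real m ^ 3 * c (3 * m) \<le> R"
proof -
  have "real m * c (2 * m + m) \<le> (\<Sum>j<m. c (2 * m + j))"
    using antimono_mult_le_sum[of c m "2 * m"] decr by simp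
  also have "\<dots> = b (2 * m) - b (3 * m)"
    unfolding c using sum_lessThan_telescope'[of "\<lambda>j. b (2 * m + j)" m] by simp
  also have "\<dots> \<le> b (2 * m)" using nonneg by simp
  finally have 1: "real m * c (3 * m) \<le> b (2 * m)" by simp
  have "real m * b (m + m) \<le> (\<Sum>j<m. b (m + j))"
    using antimono_mult_le_sum[of b m m] c nonneg(3) by simp
  also have "\<dots> = a m - a (2 * m)"
    unfolding b using sum_lessThan_telescope'[of "\<lambda>j. a (m + j)" m] by (simp add: mult_2)
  also have "\<dots> \<le> a m" using nonneg by simp
  finally have 2: "real m * b (2 * m) \<le> a m" by (simp add: mult_2)
  have 3: "real m * a m \<le> R"
    using antimono_mult_le_sum[of a m 0] b nonneg(2) sum[of m] by simp
  have "real m ^ 3 * c (3 * m) = real m * (real m * (real m * c (3 * m)))"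
    by (simp add: power3_eq_cube)
  also have "\<dots> \<le> real m * (real m * b (2 * m))" using 1 by (intro mult_left_mono) auto
  also have "\<dots> \<le> real m * a m" using 2 by (intro mult_left_mono) auto
  finally show ?thesis using 3 by linarith
qed

lemma sum_inverse_sqrt_le: "(\<Sum>k<m. 1 / sqrt (real (Suc k))) \<le> 2 * sqrt (real m)"
proof (induction m)
  case (Suc m)
  define a b where "a = sqrt (real m)" and "b = sqrt (real (Suc m))"
  have ab: "0 \<le> a" "0 < b" "a\<^sup>2 + 1 = b\<^sup>2" by (auto simp: a_def b_def)
  have "2 * (a * b) \<le> a\<^sup>2 + b\<^sup>2" using sum_squares_bound[of a b] by simp
  then have "1 / b \<le> 2 * (b - a)" using ab by (simp add: field_simps power2_eq_square)
  then show ?case using Suc by (simp add: a_def b_def)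
qed simp

text \<open>Comparison with a telescoping sum. The subtracted last term carries the induction;
  applications only keep the bound \<open>2 / sqrt (real m)\<close>.\<close>

lemma sum_three_halves_le:
  assumes "0 < m"
  shows "(\<Sum>k<N. 1 / (real (m + Suc k) * sqrt (real (m + Suc k)))) \<le> 2 / sqrt (real m) - 2 / sqrt (real (m + N))"
proof (induction N)
  case (Suc N)
  define a b where "a = sqrt (real (m + N))" and "b = sqrt (real (m + Suc N))"
  have ab: "0 < a" "0 < b" "b\<^sup>2 = a\<^sup>2 + 1" "a \<le> b" "real (m + Suc N) = b\<^sup>2"
    using assms by (auto simp: a_def b_def)
  have "(b - a) * (b + a) = 1" using ab(3) by (simp add: power2_eq_square algebra_simps)
  then have ba: "b - a = 1 / (b + a)" using ab by (simp add: field_simps)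
  have "1 / (b\<^sup>2 * b) = 2 / (b * b * (2 * b))" by (simp add: power2_eq_square)
  also have "\<dots> \<le> 2 / (a * b * (b + a))"
    using ab by (intro divide_left_mono mult_mono mult_pos_pos add_pos_pos) auto
  also have "\<dots> = 2 / (a * b) * (b - a)" unfolding ba by simp
  also have "\<dots> = 2 / a - 2 / b" using ab by (simp add: field_simps)
  finally have "1 / (b\<^sup>2 * b) \<le> 2 / a - 2 / b" .
  then have "1 / (real (m + Suc N) * sqrt (real (m + Suc N))) \<le> 2 / a - 2 / b"
    using ab(5) by (simp add: b_def)
  then show ?case using Suc by (simp add: a_def b_def)
qed simp

lemma funpow_commute:
  assumes "\<And>x. f (g x) = g (f x)"
  shows "(f ^^ k) ((g ^^ m) x) = (g ^^ m) ((f ^^ k) x)"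
proof -
  have 1: "f ((g ^^ m) x) = (g ^^ m) (f x)" for x by (induction m) (auto simp: assms)
  show ?thesis by (induction k) (auto simp: 1)
qed

section \<open>Symmetric stochastic kernels\<close>

locale symmetric_kernel =
  fixes n :: nat and p :: "nat \<Rightarrow> nat \<Rightarrow> real"
  assumes n_pos: "0 < n"
    and p_nonneg: "\<And>u v. u < n \<Longrightarrow> v < n \<Longrightarrow> 0 \<le> p u v"
    and p_sym: "\<And>u v. u < n \<Longrightarrow> v < n \<Longrightarrow> p u v = p v u"
    and p_row: "\<And>u. u < n \<Longrightarrow> (\<Sum>v<n. p u v) = 1"
begin

definition walk :: "(nat \<Rightarrow> real) \<Rightarrow> nat \<Rightarrow> real" where
  "walk g = (\<lambda>u. \<Sum>v<n. p u v * g v)"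

definition lap :: "(nat \<Rightarrow> real) \<Rightarrow> nat \<Rightarrow> real" where
  "lap g = (\<lambda>u. g u - walk g u)"

definition ip :: "(nat \<Rightarrow> real) \<Rightarrow> (nat \<Rightarrow> real) \<Rightarrow> real" where
  "ip g h = (\<Sum>u<n. g u * h u)"

definition l1 :: "(nat \<Rightarrow> real) \<Rightarrow> real" where
  "l1 g = (\<Sum>u<n. \<bar>g u\<bar>)"

definition point :: "nat \<Rightarrow> nat \<Rightarrow> real" where
  "point s = (\<lambda>u. if u = s then 1 else 0)"

lemma walk_add: "walk (\<lambda>u. g u + h u) = (\<lambda>u. walk g u + walk h u)"
  and walk_diff: "walk (\<lambda>u. g u - h u) = (\<lambda>u. walk g u - walk h u)"
  and walk_mult: "walk (\<lambda>u. c * g u) = (\<lambda>u. c * walk g u)"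
  by (simp_all add: walk_def algebra_simps sum.distrib sum_subtractf sum_distrib_left)

lemma walk_sum: "walk (\<lambda>u. \<Sum>i\<in>I. g i u) = (\<lambda>u. \<Sum>i\<in>I. walk (g i) u)"
  by (rule ext) (simp add: walk_def sum_distrib_left sum.swap[of _ I])

lemma walk_cong: "(\<And>v. v < n \<Longrightarrow> g v = h v) \<Longrightarrow> walk g u = walk h u"
  by (simp add: walk_def)

lemma walk_pow_cong: "(\<And>v. v < n \<Longrightarrow> g v = h v) \<Longrightarrow> u < n \<Longrightarrow> (walk ^^ k) g u = (walk ^^ k) h u"
  by (induction k arbitrary: u) (auto intro!: walk_cong)

lemma walk_pow_diff: "(walk ^^ k) (\<lambda>u. g u - h u) = (\<lambda>u. (walk ^^ k) g u - (walk ^^ k) h u)"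
  by (induction k) (auto simp: walk_diff)

lemma walk_const: "u < n \<Longrightarrow> walk (\<lambda>_. c) u = c"
  by (simp add: walk_def p_row sum_distrib_right[symmetric])

lemma walk_pow_const: "u < n \<Longrightarrow> (walk ^^ k) (\<lambda>_. c) u = c"
proof (induction k arbitrary: u)
  case (Suc k)
  have "(walk ^^ Suc k) (\<lambda>_. c) u = walk (\<lambda>_. c) u"
    using Suc.IH by (auto intro!: walk_cong)
  then show ?case using walk_const Suc.prems by simp
qed simp

lemma lap_walk: "lap (walk g) = walk (lap g)"
  by (simp add: lap_def walk_diff)

lemma walk_pow_lap: "(walk ^^ k) (lap g) = lap ((walk ^^ k) g)"
  using funpow_commute[of walk lap k 1 g] lap_walk by simp

lemma sum_walk: "(\<Sum>u<n. walk g u) = (\<Sum>u<n. g u)"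
proof -
  have "(\<Sum>u<n. walk g u) = (\<Sum>v<n. \<Sum>u<n. p u v * g v)"
    unfolding walk_def by (rule sum.swap)
  also have "\<dots> = (\<Sum>v<n. (\<Sum>u<n. p v u) * g v)"
    unfolding sum_distrib_right by (intro sum.cong refl) (simp add: p_sym)
  finally show ?thesis by (simp add: p_row)
qed

lemma sum_walk_pow: "(\<Sum>u<n. (walk ^^ k) g u) = (\<Sum>u<n. g u)"
  by (induction k) (auto simp: sum_walk)

lemma sum_lap: "(\<Sum>u<n. lap g u) = 0"
  by (simp add: lap_def sum_subtractf sum_walk)

lemma l1_walk_le: "l1 (walk g) \<le> l1 g"
proof -
  have "l1 (walk g) \<le> (\<Sum>u<n. walk (\<lambda>v. \<bar>g v\<bar>) u)"
    unfolding l1_def walk_def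
    by (intro sum_mono order_trans[OF sum_abs]) (simp add: abs_mult p_nonneg)
  then show ?thesis by (simp add: sum_walk l1_def)
qed

lemma l1_walk_pow_le: "l1 ((walk ^^ k) g) \<le> l1 g"
  by (induction k) (auto intro: order_trans[OF l1_walk_le])

lemma l1_diff_le: "l1 (\<lambda>u. g u - h u) \<le> l1 g + l1 h"
  unfolding l1_def sum.distrib[symmetric] by (intro sum_mono) auto

lemma l1_nonneg: "0 \<le> l1 g"
  by (simp add: l1_def sum_nonneg)

lemma l1_point: "s < n \<Longrightarrow> l1 (point s) = 1"
  by (simp add: l1_def point_def abs_if if_distrib cong: if_cong)

lemma ip_self_nonneg: "0 \<le> ip g g"
  by (simp add: ip_def sum_nonneg)

lemma ip_commute: "ip g h = ip h g"
  by (simp add: ip_def mult.commute)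

lemma ip_cong: "(\<And>u. u < n \<Longrightarrow> g u = g' u) \<Longrightarrow> (\<And>u. u < n \<Longrightarrow> h u = h' u) \<Longrightarrow> ip g h = ip g' h'"
  by (simp add: ip_def)

lemma ip_diff_right: "ip g (\<lambda>u. h u - k u) = ip g h - ip g k"
  by (simp add: ip_def algebra_simps sum_subtractf)

lemma ip_point: "s < n \<Longrightarrow> ip (point s) g = g s"
  by (simp add: ip_def point_def if_distrib[of "\<lambda>c. c * _"] cong: if_cong)

lemma ip_walk: "ip (walk g) h = ip g (walk h)"
proof -
  have "ip (walk g) h = (\<Sum>v<n. \<Sum>u<n. p u v * g v * h u)"
    unfolding ip_def walk_def sum_distrib_right by (rule sum.swap)
  also have "\<dots> = (\<Sum>v<n. \<Sum>u<n. g v * (p v u * h u))"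
    by (intro sum.cong refl) (simp add: p_sym)
  finally show ?thesis by (simp add: ip_def walk_def sum_distrib_left)
qed

lemma ip_lap: "ip (lap g) h = ip g (lap h)"
  using ip_walk[of g h] by (simp add: lap_def ip_diff_right ip_commute[of _ h])

lemma ip_walk_pow: "ip ((walk ^^ k) g) h = ip g ((walk ^^ k) h)"
  by (induction k arbitrary: g h) (auto simp: ip_walk funpow_swap1)

lemma l1_le_sqrt: "l1 g \<le> sqrt (real n * ip g g)"
proof (rule real_le_rsqrt)
  show "(l1 g)\<^sup>2 \<le> real n * ip g g"
    using sum_Cauchy_Schwarz[of "\<lambda>_. 1" "\<lambda>u. \<bar>g u\<bar>" "{..<n}"] by (simp add: l1_def ip_def power2_eq_square)
qed

lemma ip_le_l1: "ip g g \<le> (l1 g)\<^sup>2"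
proof -
  have "ip g g \<le> (\<Sum>u<n. \<bar>g u\<bar> * l1 g)"
    unfolding ip_def
  proof (intro sum_mono)
    fix u assume "u \<in> {..<n}"
    then have "\<bar>g u\<bar> \<le> l1 g" unfolding l1_def by (intro member_le_sum) auto
    then have "\<bar>g u\<bar> * \<bar>g u\<bar> \<le> \<bar>g u\<bar> * l1 g" by (intro mult_left_mono) auto
    then show "g u * g u \<le> \<bar>g u\<bar> * l1 g" by (simp add: abs_mult[symmetric])
  qed
  then show ?thesis by (simp add: sum_distrib_right[symmetric] l1_def power2_eq_square)
qed

lemma ip_le_sup: "(\<And>u. u < n \<Longrightarrow> \<bar>w u\<bar> \<le> W) \<Longrightarrow> \<bar>ip g w\<bar> \<le> W * l1 g"
  unfolding ip_def l1_def sum_distrib_left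
  by (intro order_trans[OF sum_abs] sum_mono) (auto simp: abs_mult mult.commute[of W] intro!: mult_left_mono)

lemma double_sum_left: "(\<Sum>u<n. \<Sum>v<n. p u v * g u) = (\<Sum>u<n. g u)"
  by (simp add: sum_distrib_right[symmetric] p_row)

lemma double_sum_right: "(\<Sum>u<n. \<Sum>v<n. p u v * g v) = (\<Sum>u<n. g u)"
  using sum_walk[of g] by (simp add: walk_def)

text \<open>Expand the square: both quadratic terms reduce to \<open>ip g g\<close>, because
  symmetry makes the column sums equal to 1 as well.\<close>

lemma dirichlet_form: "ip g (lap g) = (\<Sum>u<n. \<Sum>v<n. p u v * (g u - g v)\<^sup>2) / 2"
proof -
  have "(\<Sum>u<n. \<Sum>v<n. p u v * (g u - g v)\<^sup>2)
      = (\<Sum>u<n. \<Sum>v<n. p u v * (g u)\<^sup>2) + (\<Sum>u<n. \<Sum>v<n. p u v * (g v)\<^sup>2) - 2 * ip g (walk g)"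
    unfolding ip_def walk_def sum_distrib_left sum.distrib[symmetric] sum_subtractf[symmetric]
    by (intro sum.cong refl) (simp add: power2_eq_square algebra_simps)
  also have "\<dots> = 2 * ip g (lap g)"
    unfolding double_sum_left double_sum_right[of "\<lambda>v. (g v)\<^sup>2"] lap_def ip_diff_right
    by (simp add: ip_def power2_eq_square)
  finally show ?thesis by simp
qed

lemma ip_lap_nonneg: "0 \<le> ip g (lap g)"
  unfolding dirichlet_form by (auto intro!: sum_nonneg mult_nonneg_nonneg p_nonneg divide_nonneg_nonneg)

text \<open>A lower bound on the spectrum. The counterpart of the Dirichlet form with
  \<open>g u + g v\<close> equals \<open>2 * ip g g + 2 * ip g (walk g)\<close>, and its diagonal
  terms alone contribute at least \<open>4 * \<alpha> * ip g g\<close>.\<close>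

lemma ip_walk_ge:
  assumes "\<And>u. u < n \<Longrightarrow> \<alpha> \<le> p u u"
  shows "(2 * \<alpha> - 1) * ip g g \<le> ip g (walk g)"
proof -
  have "(\<Sum>u<n. \<Sum>v<n. p u v * (g u + g v)\<^sup>2)
      = (\<Sum>u<n. \<Sum>v<n. p u v * (g u)\<^sup>2) + (\<Sum>u<n. \<Sum>v<n. p u v * (g v)\<^sup>2) + 2 * ip g (walk g)"
    unfolding ip_def walk_def sum_distrib_left sum.distrib[symmetric]
    by (intro sum.cong refl) (simp add: power2_eq_square algebra_simps)
  also have "\<dots> = 2 * ip g g + 2 * ip g (walk g)"
    unfolding double_sum_left double_sum_right[of "\<lambda>v. (g v)\<^sup>2"]
    by (simp add: ip_def power2_eq_square)
  finally have eq: "(\<Sum>u<n. \<Sum>v<n. p u v * (g u + g v)\<^sup>2) = 2 * ip g g + 2 * ip g (walk g)" .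
  have "4 * \<alpha> * ip g g \<le> (\<Sum>u<n. p u u * (g u + g u)\<^sup>2)"
    unfolding ip_def sum_distrib_left
  proof (intro sum_mono)
    fix u assume "u \<in> {..<n}"
    then have "\<alpha> * (4 * (g u * g u)) \<le> p u u * (4 * (g u * g u))"
      using assms[of u] by (intro mult_right_mono) auto
    then show "4 * \<alpha> * (g u * g u) \<le> p u u * (g u + g u)\<^sup>2" by (simp add: power2_eq_square algebra_simps)
  qed
  also have "\<dots> \<le> (\<Sum>u<n. \<Sum>v<n. p u v * (g u + g v)\<^sup>2)"
  proof (intro sum_mono)
    fix u assume "u \<in> {..<n}"
    then show "p u u * (g u + g u)\<^sup>2 \<le> (\<Sum>v<n. p u v * (g u + g v)\<^sup>2)"
      by (intro member_le_sum[of u _ "\<lambda>v. p u v * (g u + g v)\<^sup>2"]) (auto intro: mult_nonneg_nonneg p_nonneg)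
  qed
  finally show ?thesis using eq by (simp add: algebra_simps)
qed

text \<open>By symmetry of the kernel this is the absolute row sum at \<open>s\<close> of P^k (I -
  P), the quantity called D_k in the overview.\<close>

definition drift :: "nat \<Rightarrow> nat \<Rightarrow> real" where
  "drift s k = l1 ((walk ^^ k) (lap (point s)))"

lemma drift_nonneg: "0 \<le> drift s k"
  by (simp add: drift_def l1_nonneg)

lemma drift_le_2: "s < n \<Longrightarrow> drift s k \<le> 2"
  unfolding drift_def
  using l1_walk_pow_le[of k "lap (point s)"] l1_diff_le[of "point s" "walk (point s)"]
    l1_walk_le[of "point s"] l1_point[of s] by (simp add: lap_def)

text \<open>Self-adjointness moves the operators from \<open>w\<close> to the point mass at
  \<open>s\<close>; what remains is the duality of the l1 and the sup norm.\<close>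

lemma walk_pow_lap_le_drift:
  assumes "s < n" "\<And>u. u < n \<Longrightarrow> \<bar>w u\<bar> \<le> W"
  shows "\<bar>(walk ^^ k) (lap w) s\<bar> \<le> W * drift s k"
proof -
  have "(walk ^^ k) (lap w) s = ip (point s) ((walk ^^ k) (lap w))" using assms(1) by (simp add: ip_point)
  also have "\<dots> = ip (lap ((walk ^^ k) (point s))) w" by (simp add: ip_walk_pow ip_lap)
  also have "lap ((walk ^^ k) (point s)) = (walk ^^ k) (lap (point s))" by (simp add: walk_pow_lap)
  finally show ?thesis using ip_le_sup[of w W] assms(2) by (simp add: drift_def)
qed

text \<open>Summation by parts is built into the induction: the walk carries \<open>\<psi> t\<close>
  to the next step, and its difference from the subtracted \<open>\<psi> t\<close> is
  \<open>- lap (\<psi> t)\<close>. So \<open>\<psi>\<close> joins the source term with its index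
  lowered by one, and only its latest value stays outside \<open>lap\<close>.\<close>

lemma recurrence_solution:
  assumes rec: "\<And>t u. 1 \<le> t \<Longrightarrow> u < n \<Longrightarrow>
      y (t + 1) u = walk (y t) u + lap (r t) u + (\<psi> t u - \<psi> (t - 1) u)"
    and \<psi>0: "\<And>u. \<psi> 0 u = 0" and u: "u < n"
  shows "y (t + 1) u = (walk ^^ t) (y 1) u + \<psi> t u
      + (\<Sum>s<t. (walk ^^ s) (lap (\<lambda>v. r (t - s) v - \<psi> (t - s - 1) v)) u)"
  using u
proof (induction t arbitrary: u)
  case 0
  then show ?case by (simp add: \<psi>0)
next
  case (Suc t)
  let ?w = "\<lambda>t v. r t v - \<psi> (t - 1) v"
  have "walk (y (Suc t)) u = walk (\<lambda>u. (walk ^^ t) (y 1) u + \<psi> t u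
      + (\<Sum>s<t. (walk ^^ s) (lap (?w (t - s))) u)) u"
    using Suc.IH by (intro walk_cong) simp
  also have "\<dots> = (walk ^^ Suc t) (y 1) u + walk (\<psi> t) u + (\<Sum>s<t. (walk ^^ Suc s) (lap (?w (t - s))) u)"
    by (simp add: walk_add walk_sum)
  finally have "y (Suc t + 1) u = (walk ^^ Suc t) (y 1) u + \<psi> (Suc t) u
      + (lap (r (Suc t)) u - lap (\<psi> t) u + (\<Sum>s<t. (walk ^^ Suc s) (lap (?w (t - s))) u))"
    using rec[of "Suc t" u] Suc.prems by (simp add: lap_def)
  also have "lap (r (Suc t)) u - lap (\<psi> t) u = lap (?w (Suc t)) u"
    by (simp add: lap_def walk_diff)
  also have "lap (?w (Suc t)) u + (\<Sum>s<t. (walk ^^ Suc s) (lap (?w (t - s))) u)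
      = (\<Sum>s<Suc t. (walk ^^ s) (lap (?w (Suc t - s))) u)"
    by (subst sum.lessThan_Suc_shift) simp
  finally show ?case by simp
qed

end

section \<open>Kernels that contract the Euclidean norm of functions with sum zero\<close>

locale contracting_kernel = symmetric_kernel +
  fixes \<rho> :: real
  assumes rho_nonneg: "0 \<le> \<rho>" and rho_less_1: "\<rho> < 1"
    and contraction: "\<And>g. (\<Sum>u<n. g u) = 0 \<Longrightarrow> ip (walk g) (walk g) \<le> \<rho>\<^sup>2 * ip g g"
begin

lemma contraction_pow:
  assumes "(\<Sum>u<n. g u) = 0"
  shows "ip ((walk ^^ k) g) ((walk ^^ k) g) \<le> (\<rho> ^ k)\<^sup>2 * ip g g"
proof (induction k)
  case (Suc k)
  have "ip ((walk ^^ Suc k) g) ((walk ^^ Suc k) g) \<le> \<rho>\<^sup>2 * ip ((walk ^^ k) g) ((walk ^^ k) g)"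
    using contraction[of "(walk ^^ k) g"] assms by (simp add: sum_walk_pow)
  also have "\<dots> \<le> \<rho>\<^sup>2 * ((\<rho> ^ k)\<^sup>2 * ip g g)" using Suc by (intro mult_left_mono) auto
  finally show ?case by (simp add: power_mult_distrib mult.assoc)
qed simp

text \<open>The factor \<open>sqrt (real n)\<close> is the price of passing from the l1 norm to the
  Euclidean norm and back.\<close>

lemma l1_contraction:
  assumes "(\<Sum>u<n. g u) = 0"
  shows "l1 ((walk ^^ k) g) \<le> sqrt (real n) * \<rho> ^ k * l1 g"
proof -
  have "l1 ((walk ^^ k) g) \<le> sqrt (real n * ip ((walk ^^ k) g) ((walk ^^ k) g))" by (rule l1_le_sqrt)
  also have "\<dots> \<le> sqrt (real n * ((\<rho> ^ k)\<^sup>2 * (l1 g)\<^sup>2))"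
    by (intro real_sqrt_le_mono mult_left_mono order_trans[OF contraction_pow[OF assms]] ip_le_l1) auto
  also have "\<dots> = sqrt (real n) * \<rho> ^ k * l1 g"
    using rho_nonneg l1_nonneg[of g] by (simp add: real_sqrt_mult)
  finally show ?thesis .
qed

text \<open>A single value is at most the Euclidean norm, and the Euclidean norm of \<open>g\<close>
  is at most \<open>sqrt (real n) * K\<close>.\<close>

lemma sup_contraction:
  assumes "(\<Sum>u<n. g u) = 0" "\<And>u. u < n \<Longrightarrow> \<bar>g u\<bar> \<le> K" "s < n"
  shows "\<bar>(walk ^^ k) g s\<bar> \<le> \<rho> ^ k * (sqrt (real n) * K)"
proof (rule power2_le_imp_le)
  have K: "0 \<le> K" using assms(2)[OF assms(3)] by linarith
  have "((walk ^^ k) g s)\<^sup>2 \<le> ip ((walk ^^ k) g) ((walk ^^ k) g)"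
    unfolding ip_def power2_eq_square using assms(3) by (intro member_le_sum) auto
  also have "\<dots> \<le> (\<rho> ^ k)\<^sup>2 * ip g g" by (rule contraction_pow[OF assms(1)])
  also have "ip g g \<le> (\<Sum>u<n. K\<^sup>2)"
    unfolding ip_def
    by (intro sum_mono) (use assms(2) in \<open>auto simp: power2_eq_square[symmetric] intro: sqrt_le_D abs_le_square_iff[THEN iffD1] order_trans\<close>)
  finally show "\<bar>(walk ^^ k) g s\<bar>\<^sup>2 \<le> (\<rho> ^ k * (sqrt (real n) * K))\<^sup>2"
    by (simp add: power_mult_distrib mult_left_mono)
  show "0 \<le> \<rho> ^ k * (sqrt (real n) * K)" using K rho_nonneg by simp
qed

text \<open>Shifting by \<open>T\<close> halves the drift, so the full sum is at most its first
  \<open>T\<close> terms plus half of itself.\<close>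

lemma sum_drift_le:
  assumes s: "s < n" and T: "sqrt (real n) * \<rho> ^ T \<le> 1 / 2"
  shows "(\<Sum>k<t. drift s k) \<le> 2 * (\<Sum>k<T. drift s k)"
proof -
  have half: "drift s (T + k) \<le> drift s k / 2" for k
  proof -
    have "drift s (T + k) \<le> sqrt (real n) * \<rho> ^ T * drift s k"
      unfolding drift_def funpow_add o_def
      by (rule l1_contraction) (simp add: sum_walk_pow sum_lap)
    also have "\<dots> \<le> 1 / 2 * drift s k" using T drift_nonneg by (intro mult_right_mono) auto
    finally show ?thesis by simp
  qed
  have "(\<Sum>k<t. drift s k) \<le> (\<Sum>k<T + t. drift s k)"
    by (intro sum_mono2) (auto simp: drift_nonneg)
  also have "\<dots> = (\<Sum>k<T. drift s k) + (\<Sum>k<t. drift s (T + k))"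
    by (induction t) (auto simp: add.assoc)
  also have "(\<Sum>k<t. drift s (T + k)) \<le> (\<Sum>k<t. drift s k) / 2"
    unfolding sum_divide_distrib using half by (intro sum_mono) auto
  finally show ?thesis by simp
qed

end

section \<open>Lazy kernels: decay of the drift and complete monotonicity\<close>

locale lazy_kernel = symmetric_kernel +
  assumes lazy: "\<And>u. u < n \<Longrightarrow> 1 / 2 \<le> p u u"
begin

text \<open>With P = (I + Q) / 2, the power P^k is a binomial average of the Q^j, and I - P is (I -
  Q) / 2. Collecting the differences gives signed weights on the Q^j whose total size is a binomial
  mean deviation, while each Q^j applied to a point mass has l1 norm at most 1.\<close>

lemma drift_le_inverse_sqrt:
  assumes s: "s < n"
  shows "drift s k \<le> 1 / sqrt (real (Suc k))"
proof -
  \<comment> \<open>This is Q = 2 P - I; laziness is what makes its diagonal nonnegative.\<close>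
  define q where "q u v = 2 * p u v - (if u = v then 1 else 0)" for u v
  interpret Q: symmetric_kernel n q
  proof
    show "0 \<le> q u v" if "u < n" "v < n" for u v
      using p_nonneg[OF that] lazy[OF that(1)] by (auto simp: q_def)
    show "(\<Sum>v<n. q u v) = 1" if "u < n" for u
      using p_row[OF that] that by (simp add: q_def sum_subtractf sum_distrib_left[symmetric])
  qed (auto simp: q_def n_pos p_sym)
  have half: "walk g u = (g u + Q.walk g u) / 2" if "u < n" for g u
  proof -
    have "Q.walk g u = 2 * walk g u - (\<Sum>v<n. (if u = v then 1 else 0) * g v)"
      unfolding walk_def Q.walk_def q_def by (simp add: left_diff_distrib sum_subtractf sum_distrib_left mult.assoc)
    also have "(\<Sum>v<n. (if u = v then 1 else 0) * g v) = g u"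
      using that by (simp add: if_distrib[of "\<lambda>c. c * _"] cong: if_cong)
    finally show ?thesis by simp
  qed
  have binom: "(walk ^^ k) g u = (\<Sum>j\<le>k. real (k choose j) * (Q.walk ^^ j) g u) / 2 ^ k" if "u < n" for g u k
    using that
  proof (induction k arbitrary: u)
    case (Suc k)
    have "Q.walk ((walk ^^ k) g) u = Q.walk (\<lambda>u. (1 / 2 ^ k) * (\<Sum>j\<le>k. real (k choose j) * (Q.walk ^^ j) g u)) u"
      using Suc.IH by (intro Q.walk_cong) simp
    also have "\<dots> = (\<Sum>j\<le>k. real (k choose j) * (Q.walk ^^ Suc j) g u) / 2 ^ k"
      by (simp only: Q.walk_mult Q.walk_sum) simp
    finally have "(walk ^^ Suc k) g u
        = (\<Sum>j\<le>k. real (k choose j) * ((Q.walk ^^ j) g u + (Q.walk ^^ Suc j) g u)) / 2 ^ Suc k"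
      using Suc by (simp add: half distrib_left sum.distrib add_divide_distrib)
    then show ?case by (simp only: sum_binomial_Suc)
  qed simp
  define m where "m = Suc k"
  have expand: "(walk ^^ k) (lap (point s)) u
      = (\<Sum>j\<le>m. real (m choose j) * (real m - 2 * real j) * (Q.walk ^^ j) (point s) u) / (real m * 2 ^ m)"
    if u: "u < n" for u
  proof -
    let ?g = "\<lambda>u. 1 / 2 * point s u - 1 / 2 * Q.walk (point s) u"
    have shift: "(Q.walk ^^ j) ?g
        = (\<lambda>u. ((Q.walk ^^ j) (point s) u - (Q.walk ^^ Suc j) (point s) u) / 2)" for j
    proof -
      have half_pow: "(Q.walk ^^ j) (\<lambda>u. 1 / 2 * g u) = (\<lambda>u. 1 / 2 * (Q.walk ^^ j) g u)" for g :: "nat \<Rightarrow> real"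
        by (induction j) (auto simp only: funpow.simps id_apply o_def Q.walk_mult)
      show ?thesis
        unfolding Q.walk_pow_diff half_pow[of "point s"] half_pow[of "Q.walk (point s)"] funpow_Suc_right o_apply
        by (simp add: diff_divide_distrib)
    qed
    have "(walk ^^ k) (lap (point s)) u = (walk ^^ k) ?g u"
      using u by (intro walk_pow_cong) (simp_all add: lap_def half field_simps)
    also have "\<dots> = (\<Sum>j\<le>k. real (k choose j) * (Q.walk ^^ j) ?g u) / 2 ^ k"
      by (rule binom[OF u])
    also have "\<dots> = (\<Sum>j\<le>k. real (k choose j) * ((Q.walk ^^ j) (point s) u - (Q.walk ^^ Suc j) (point s) u)) / 2 ^ m"
      unfolding shift by (simp add: m_def sum_divide_distrib[symmetric])
    finally show ?thesis
      unfolding sum_binomial_difference[of k "\<lambda>j. (Q.walk ^^ j) (point s) u"] m_def[symmetric]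
      by (simp only: divide_divide_eq_left)
  qed
  have Q1: "Q.l1 ((Q.walk ^^ j) (point s)) \<le> 1" for j
    using Q.l1_walk_pow_le[of j "point s"] l1_point[OF s] by (simp add: l1_def Q.l1_def)
  have "drift s k \<le> (\<Sum>u<n. \<Sum>j\<le>m. real (m choose j) * \<bar>real m - 2 * real j\<bar>
      * \<bar>(Q.walk ^^ j) (point s) u\<bar> / (real m * 2 ^ m))"
    unfolding drift_def l1_def
  proof (intro sum_mono)
    fix u assume "u \<in> {..<n}"
    then show "\<bar>(walk ^^ k) (lap (point s)) u\<bar> \<le> (\<Sum>j\<le>m. real (m choose j) * \<bar>real m - 2 * real j\<bar>
      * \<bar>(Q.walk ^^ j) (point s) u\<bar> / (real m * 2 ^ m))"
      by (simp only: expand lessThan_iff sum_divide_distrib)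
        (intro order_trans[OF sum_abs] sum_mono, simp add: abs_mult)
  qed
  also have "\<dots> = (\<Sum>j\<le>m. \<Sum>u<n. real (m choose j) * \<bar>real m - 2 * real j\<bar>
      * \<bar>(Q.walk ^^ j) (point s) u\<bar> / (real m * 2 ^ m))" by (rule sum.swap)
  also have "\<dots> = (\<Sum>j\<le>m. real (m choose j) * \<bar>real m - 2 * real j\<bar> * Q.l1 ((Q.walk ^^ j) (point s))) / (real m * 2 ^ m)"
    by (simp add: Q.l1_def sum_distrib_left sum_divide_distrib)
  also have "\<dots> \<le> (\<Sum>j\<le>m. real (m choose j) * \<bar>real m - 2 * real j\<bar> * 1) / (real m * 2 ^ m)"
    using Q1 by (intro divide_right_mono sum_mono mult_left_mono) auto
  also have "\<dots> \<le> 2 ^ m * sqrt (real m) / (real m * 2 ^ m)"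
    using binomial_mean_deviation[of m] by (intro divide_right_mono) auto
  also have "\<dots> = 1 / sqrt (real m)"
    by (simp add: m_def frac_eq_eq)
  finally show ?thesis by (simp add: m_def)
qed

lemma ip_walk_nonneg: "0 \<le> ip g (walk g)"
  using ip_walk_ge[OF lazy] by simp

text \<open>With L = I - P one has P L = P L P + L P L, because P + L = I and the operators commute;
  both summands are nonnegative forms.\<close>

lemma ip_walk_lap_nonneg: "0 \<le> ip g (walk (lap g))"
proof -
  have "ip (walk g) (lap (walk g)) + ip (lap g) (walk (lap g))
      = ip g (walk (walk (lap g))) + ip g (lap (walk (lap g)))"
    by (simp add: ip_walk ip_lap lap_walk)
  also have "\<dots> = ip g (walk (lap g))"
    by (simp add: lap_def[of "walk (lap g)"] ip_diff_right)
  finally show ?thesis using ip_lap_nonneg[of "walk g"] ip_walk_nonneg[of "lap g"] by simp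
qed

text \<open>Complete monotonicity of \<open>ip z ((walk ^^ j) z)\<close> in \<open>j\<close>. Two
  equal factors can be distributed to the two sides of the inner product, so both inductions go down
  by two and end at exponents 0 and 1.\<close>

lemma ip_walk_pow_lap_pow_nonneg: "0 \<le> ip z ((walk ^^ j) ((lap ^^ m) z))"
proof (induction j arbitrary: z rule: induct_nat_012)
  case 0
  show ?case
  proof (induction m arbitrary: z rule: induct_nat_012)
    case (ge2 m)
    from ge2(1)[of "lap z"] show ?case by (simp add: ip_lap funpow_swap1)
  qed (auto simp: ip_self_nonneg ip_lap_nonneg)
next
  case 1
  show ?case
  proof (induction m arbitrary: z rule: induct_nat_012)
    case (ge2 m)
    from ge2(1)[of "lap z"] show ?case by (simp add: ip_lap lap_walk funpow_swap1)
  qed (auto simp: ip_walk_nonneg ip_walk_lap_nonneg)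
next
  case (ge2 j)
  have "(lap ^^ m) (walk z) = walk ((lap ^^ m) z)"
    using funpow_commute[of lap walk m 1 z] by (simp add: lap_walk)
  with ge2(1)[of "walk z"] show ?case by (simp add: ip_walk funpow_swap1)
qed

text \<open>Cauchy-Schwarz reduces the drift to the Euclidean norm of P^k (I - P) z, whose square is
  the second difference at \<open>2 * k\<close> of the return probabilities minus 1/n. That sequence
  is completely monotone with sum at most \<open>R\<close>, so its second differences decay
  cubically.\<close>

lemma drift_le_three_halves:
  assumes s: "s < n" and k: "2 \<le> k"
    and R: "\<And>N. (\<Sum>j<N. ip (\<lambda>u. point s u - 1 / real n) ((walk ^^ j) (\<lambda>u. point s u - 1 / real n))) \<le> R"
  shows "drift s k \<le> sqrt (8 * real n * R) / (real k * sqrt (real k))"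
proof -
  define z where "z = (\<lambda>u. point s u - 1 / real n)"
  define F where "F m j = ip z ((walk ^^ j) ((lap ^^ m) z))" for m j
  have F_nonneg: "0 \<le> F m j" for m j by (simp add: F_def ip_walk_pow_lap_pow_nonneg)
  have F_Suc: "F (Suc m) j = F m j - F m (Suc j)" for m j
  proof -
    have "(lap ^^ Suc m) z = (\<lambda>u. (lap ^^ m) z u - walk ((lap ^^ m) z) u)"
      by (simp only: funpow.simps o_apply lap_def[of "(lap ^^ m) z"])
    then show ?thesis
      by (simp only: F_def walk_pow_diff ip_diff_right) (simp add: funpow_swap1)
  qed
  have decr: "F m (Suc j) \<le> F m j" for m j using F_Suc[of m j] F_nonneg[of "Suc m" j] by simp
  \<comment> \<open>A multiple of 3 below \<open>2 * k\<close> is needed to apply the decay bound;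
    \<open>2 \<le> k\<close> ensures that rounding down still leaves \<open>k \<le> 2 * m\<close>,
    which costs a factor 2^3 = 8.\<close>
  define m where "m = (2 * k) div 3"
  have m: "3 * m \<le> 2 * k" "k \<le> 2 * m" using k by (auto simp: m_def)
  have "real m ^ 3 * F 2 (3 * m) \<le> R"
  proof (rule second_difference_decay[of "F 1" "F 0" "F 2"])
    show "(\<Sum>j<N. F 0 j) \<le> R" for N using R[of N] by (simp add: F_def z_def)
    show "F 1 j = F 0 j - F 0 (Suc j)" for j using F_Suc[of 0 j] by simp
    show "F 2 j = F 1 j - F 1 (Suc j)" for j using F_Suc[of 1 j] by (simp add: numeral_2_eq_2)
  qed (rule F_nonneg decr)+
  moreover have "F 2 (2 * k) \<le> F 2 (3 * m)"
    using lift_Suc_antimono_le[of "F 2" "3 * m" "2 * k"] decr m(1) by blast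
  moreover have "real k ^ 3 \<le> 8 * real m ^ 3"
    using power_mono[of "real k" "2 * real m" 3] m(2) by (simp add: power_mult_distrib)
  ultimately have F2: "real k ^ 3 * F 2 (2 * k) \<le> 8 * R"
    using mult_mono[of "real k ^ 3" "8 * real m ^ 3" "F 2 (2 * k)" "F 2 (3 * m)"] F_nonneg by simp
  \<comment> \<open>Subtracting the mean does not change the Laplacian.\<close>
  have lap_z: "lap (point s) u = lap z u" if "u < n" for u
    using that by (simp add: lap_def z_def walk_diff walk_const)
  have "drift s k = l1 ((walk ^^ k) (lap z))"
    unfolding drift_def l1_def using lap_z by (intro sum.cong refl arg_cong[of _ _ abs] walk_pow_cong) auto
  also have "\<dots> \<le> sqrt (real n * ip ((walk ^^ k) (lap z)) ((walk ^^ k) (lap z)))" by (rule l1_le_sqrt)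
  also have "ip ((walk ^^ k) (lap z)) ((walk ^^ k) (lap z)) = F 2 (2 * k)"
    by (simp add: F_def ip_walk_pow ip_lap walk_pow_lap[symmetric] funpow_add mult_2 numeral_2_eq_2)
  also have "sqrt (real n * F 2 (2 * k)) \<le> sqrt (8 * real n * R / real k ^ 3)"
    using mult_left_mono[OF F2, of "real n"] k by (intro real_sqrt_le_mono) (simp add: field_simps)
  also have "\<dots> = sqrt (8 * real n * R) / (real k * sqrt (real k))"
    by (simp add: real_sqrt_divide power3_eq_cube real_sqrt_mult)
  finally show ?thesis .
qed

end

section \<open>From the spectrum to contraction\<close>

lemma second_largest_add_max:
  assumes "M \<noteq> {#}" "\<And>y. y \<in># M \<Longrightarrow> y \<le> x"
  shows "second_largest (add_mset x M) \<in># M" "y \<in># M \<Longrightarrow> y \<le> second_largest (add_mset x M)"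
proof -
  define l where "l = sorted_list_of_multiset M"
  have l: "sorted l" "mset l = M" by (simp_all add: l_def)
  then have set_l: "set l = set_mset M" by (metis set_mset_mset)
  have "sorted (l @ [x])" using l set_l assms(2) by (auto simp: sorted_append)
  moreover have "mset (l @ [x]) = add_mset x M" using l by simp
  ultimately have "sorted_list_of_multiset (add_mset x M) = l @ [x]"
    by (metis sorted_list_of_multiset_mset sorted_sort_id)
  moreover have "l \<noteq> []" using l assms(1) by auto
  \<comment> \<open>The added maximum comes first in the reversed list, so index 1 is the largest
    element of \<open>M\<close>, also when it ties with \<open>x\<close>.\<close>
  ultimately have last: "second_largest (add_mset x M) = last l"
    by (simp add: second_largest_def hd_rev[symmetric] hd_conv_nth)
  show "second_largest (add_mset x M) \<in># M"
    unfolding last set_l[symmetric] using \<open>l \<noteq> []\<close> by simp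
  show "y \<le> second_largest (add_mset x M)" if y: "y \<in># M"
  proof -
    obtain i where "i < length l" "l ! i = y" using y unfolding set_l[symmetric] in_set_conv_nth by blast
    then show ?thesis
      unfolding last last_conv_nth[OF \<open>l \<noteq> []\<close>] using sorted_nth_mono[OF l(1), of i "length l - 1"] by simp
  qed
qed

context symmetric_kernel
begin

text \<open>One basis vector not orthogonal to the constants has eigenvalue 1; \<open>I\<close>
  indexes all the others. Unit functions realizing \<open>e i\<close> as a quadratic form are
  supplied so that the diagonal of the kernel can bound the eigenvalues from below.\<close>

lemma eigenvalue_structure:
  "\<exists>e I. I \<subseteq> {..<n} \<and> card I = n - 1 \<and>
    eigenvalues_mset (mat n n (\<lambda>(u, v). p u v)) = add_mset 1 (image_mset e (mset_set I)) \<and>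
    (\<forall>i\<in>I. \<bar>e i\<bar> \<le> 1 \<and> (\<exists>g. ip g g = 1 \<and> ip g (walk g) = e i)) \<and>
    (\<forall>g \<rho>. (\<forall>i\<in>I. \<bar>e i\<bar> \<le> \<rho>) \<longrightarrow> \<rho> < 1 \<longrightarrow> (\<Sum>u<n. g u) = 0 \<longrightarrow>
       ip (walk g) (walk g) \<le> \<rho>\<^sup>2 * ip g g)"
proof -
  obtain e w where
    ev: "eigenvalues_mset (mat n n (\<lambda>(u, v). p u v)) = image_mset e (mset_set {..<n})"
    and eig: "\<And>i u. i < n \<Longrightarrow> u < n \<Longrightarrow> (\<Sum>v<n. p u v * w i v) = e i * w i u"
    and orth: "\<And>i j. i < n \<Longrightarrow> j < n \<Longrightarrow> (\<Sum>u<n. w i u * w j u) = (if i = j then 1 else 0)"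
    and compl: "\<And>u v. u < n \<Longrightarrow> v < n \<Longrightarrow> (\<Sum>i<n. w i u * w i v) = (if u = v then 1 else 0)"
    using symmetric_eigenbasis[of n p] p_sym by blast
  have norm: "ip (w i) (w i) = 1" if "i < n" for i using orth[OF that that] by (simp add: ip_def)
  have walk_w: "walk (w i) u = e i * w i u" if "i < n" "u < n" for i u
    using eig[OF that] by (simp add: walk_def)
  have parseval: "ip g h = (\<Sum>i<n. ip g (w i) * ip h (w i))" for g h
  proof -
    have "(\<Sum>i<n. ip g (w i) * ip h (w i)) = (\<Sum>i<n. \<Sum>u<n. \<Sum>v<n. g u * h v * (w i u * w i v))"
      by (simp add: ip_def sum_product mult.assoc mult.left_commute)
    also have "\<dots> = (\<Sum>u<n. \<Sum>i<n. \<Sum>v<n. g u * h v * (w i u * w i v))" by (rule sum.swap)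
    also have "\<dots> = (\<Sum>u<n. \<Sum>v<n. \<Sum>i<n. g u * h v * (w i u * w i v))"
      by (rule sum.cong[OF refl]) (rule sum.swap)
    also have "\<dots> = (\<Sum>u<n. \<Sum>v<n. if u = v then g u * h v else 0)"
      unfolding sum_distrib_left[symmetric] by (intro sum.cong refl) (simp add: compl)
    also have "\<dots> = ip g h" by (simp add: ip_def)
    finally show ?thesis by simp
  qed
  have coeff: "ip (walk g) (w i) = e i * ip g (w i)" if "i < n" for g i
  proof -
    have "ip (walk g) (w i) = ip g (\<lambda>u. e i * w i u)"
      unfolding ip_walk using walk_w[OF that] by (intro ip_cong) auto
    then show ?thesis by (simp add: ip_def sum_distrib_left mult.left_commute)
  qed
  let ?one = "\<lambda>_ :: nat. 1 :: real"
  \<comment> \<open>The walk fixes constants, so the coefficient of the constant function is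
    unchanged when multiplied by \<open>e i\<close>.\<close>
  have one: "e i = 1 \<or> ip ?one (w i) = 0" if "i < n" for i
  proof -
    have "ip (walk ?one) (w i) = ip ?one (w i)" by (intro ip_cong) (auto simp: walk_const)
    then show ?thesis using coeff[OF that, of ?one] by auto
  qed
  have "\<exists>i<n. ip ?one (w i) \<noteq> 0"
  proof (rule ccontr)
    assume "\<not> ?thesis"
    then have "ip ?one ?one = 0" unfolding parseval[of ?one ?one] by (intro sum.neutral) auto
    then show False using n_pos by (simp add: ip_def)
  qed
  then obtain k where k: "k < n" "ip ?one (w k) \<noteq> 0" by blast
  then have ek: "e k = 1" using one by blast
  define I where "I = {..<n} - {k}"
  have ins: "{..<n} = insert k I" "k \<notin> I" "finite I" using k by (auto simp: I_def)
  have ip_w: "ip (w i) (walk (w i)) = e i" if "i < n" for i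
    using coeff[OF that, of "w i"] norm[OF that] by (simp add: ip_commute)
  show ?thesis
  proof (rule exI[of _ e], rule exI[of _ I], intro conjI ballI allI impI)
    show "I \<subseteq> {..<n}" "card I = n - 1" using k by (auto simp: I_def)
    show "eigenvalues_mset (mat n n (\<lambda>(u, v). p u v)) = add_mset 1 (image_mset e (mset_set I))"
      unfolding ev ins(1) using ins ek by simp
  next
    fix i assume "i \<in> I"
    then have i: "i < n" by (simp add: I_def)
    have "l1 (walk (w i)) = \<bar>e i\<bar> * l1 (w i)"
      unfolding l1_def sum_distrib_left by (intro sum.cong refl) (simp add: walk_w[OF i] abs_mult)
    then have "\<bar>e i\<bar> * l1 (w i) \<le> 1 * l1 (w i)" using l1_walk_le[of "w i"] by simp
    moreover have "0 < l1 (w i)"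
      using ip_le_l1[of "w i"] norm[OF i] l1_nonneg[of "w i"] by (cases "l1 (w i) = 0") auto
    ultimately show "\<bar>e i\<bar> \<le> 1" by (simp only: mult_le_cancel_right)
    show "\<exists>g. ip g g = 1 \<and> ip g (walk g) = e i" using norm[OF i] ip_w[OF i] by blast
  next
    fix g :: "nat \<Rightarrow> real" and \<rho> assume \<rho>: "\<forall>i\<in>I. \<bar>e i\<bar> \<le> \<rho>" "\<rho> < 1" and g: "(\<Sum>u<n. g u) = 0"
    \<comment> \<open>Eigenvalues below 1 force orthogonality to the constants. Hence the constant
      function is a multiple of \<open>w k\<close>, and \<open>g\<close>, having sum zero, has no
      component along \<open>w k\<close>.\<close>
    have "ip ?one (w i) = 0" if "i \<in> I" for i
      using bspec[OF \<rho>(1) that] \<rho>(2) one[of i] that by (auto simp: I_def)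
    then have "ip g ?one = ip g (w k) * ip ?one (w k)"
      unfolding parseval[of g ?one] ins(1) using ins by simp
    then have gk: "ip g (w k) = 0" using g k(2) by (simp add: ip_def)
    have "ip (walk g) (walk g) = (\<Sum>i<n. (e i)\<^sup>2 * (ip g (w i))\<^sup>2)"
      unfolding parseval[of "walk g" "walk g"] by (intro sum.cong refl) (simp add: coeff power2_eq_square algebra_simps)
    also have "\<dots> \<le> (\<Sum>i<n. \<rho>\<^sup>2 * (ip g (w i))\<^sup>2)"
    proof (intro sum_mono)
      fix i assume "i \<in> {..<n}"
      then consider "i = k" | "i \<in> I" using ins by auto
      then show "(e i)\<^sup>2 * (ip g (w i))\<^sup>2 \<le> \<rho>\<^sup>2 * (ip g (w i))\<^sup>2"
      proof cases
        case 2
        then have "\<bar>e i\<bar> \<le> \<bar>\<rho>\<bar>" using bspec[OF \<rho>(1) 2] by simp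
        then show ?thesis by (intro mult_right_mono) (auto simp: abs_le_square_iff)
      qed (simp add: gk)
    qed
    also have "\<dots> = \<rho>\<^sup>2 * ip g g"
      unfolding parseval[of g g] sum_distrib_left by (simp add: power2_eq_square)
    finally show "ip (walk g) (walk g) \<le> \<rho>\<^sup>2 * ip g g" .
  qed
qed

end

section \<open>The random walk on the balancing graph\<close>

definition walk_kernel :: "nat \<Rightarrow> (nat \<times> nat) set \<Rightarrow> nat \<Rightarrow> nat \<Rightarrow> nat \<Rightarrow> real" where
  "walk_kernel d E dl u v = (if (u, v) \<in> E then 1 / real (d + dl)
     else if u = v then real dl / real (d + dl) else 0)"

locale balancing_graph =
  fixes n d :: nat and E :: "(nat \<times> nat) set" and dl :: nat
  assumes reg: "regular_graph n d E" and d_pos: "1 \<le> d" and dl_pos: "1 \<le> dl"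
begin

abbreviation p :: "nat \<Rightarrow> nat \<Rightarrow> real" where "p \<equiv> walk_kernel d E dl"

lemma E_less: "(u, v) \<in> E \<Longrightarrow> u < n" "(u, v) \<in> E \<Longrightarrow> v < n"
  and E_irrefl: "(u, u) \<notin> E" and E_sym: "(u, v) \<in> E \<Longrightarrow> (v, u) \<in> E"
  and degree: "u < n \<Longrightarrow> card (E `` {u}) = d"
  using reg by (auto simp: regular_graph_def irrefl_def sym_def)

lemma finite_E: "finite E"
proof (rule finite_subset)
  show "E \<subseteq> {..<n} \<times> {..<n}" using reg by (simp add: regular_graph_def)
qed simp

lemma finite_nbrs: "finite (E `` {u})"
  using finite_E by simp

text \<open>A neighbour differs from its node. This leaves an eigenvalue besides the top one and
  keeps \<open>ln (real n)\<close> away from 0.\<close>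

lemma n_ge_2: "2 \<le> n"
proof -
  have n: "0 < n" using reg by (simp add: regular_graph_def)
  then have "E `` {0} \<noteq> {}" using degree[of 0] d_pos by auto
  then obtain v where v: "(0, v) \<in> E" by auto
  then have "v \<noteq> 0" using E_irrefl[of 0] by metis
  moreover have "v < n" using v E_less by blast
  ultimately show ?thesis by simp
qed

lemma sum_over_nbrs: "u < n \<Longrightarrow> (\<Sum>v<n. if (u, v) \<in> E then h v else (0::real)) = (\<Sum>v\<in>E `` {u}. h v)"
  by (rule sum.mono_neutral_cong_right) (auto simp: E_less)

lemma walk_kernel_apply:
  assumes "u < n"
  shows "(\<Sum>v<n. p u v * g v) = ((\<Sum>v\<in>E `` {u}. g v) + real dl * g u) / real (d + dl)"
proof -
  have "(\<Sum>v<n. p u v * g v) = (\<Sum>v<n. (if (u, v) \<in> E then g v / real (d + dl) else 0)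
      + (if u = v then real dl * g v / real (d + dl) else 0))"
    by (intro sum.cong refl) (auto simp: walk_kernel_def E_irrefl)
  also have "\<dots> = (\<Sum>v\<in>E `` {u}. g v / real (d + dl)) + real dl * g u / real (d + dl)"
    unfolding sum.distrib sum_over_nbrs[OF assms] using assms by simp
  finally show ?thesis by (simp add: sum_divide_distrib add_divide_distrib)
qed

sublocale symmetric_kernel n p
proof
  show "0 < n" using n_ge_2 by simp
  show "(\<Sum>v<n. p u v) = 1" if "u < n" for u
    using walk_kernel_apply[OF that, of "\<lambda>_. 1"] degree[OF that] d_pos by simp
  show "p u v = p v u" for u v
    using E_sym[of u v] E_sym[of v u] by (auto simp: walk_kernel_def)
qed (simp add: walk_kernel_def)

lemma p_diag: "real dl / real (d + dl) = p u u"
  by (simp add: walk_kernel_def E_irrefl)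

lemma transition_matrix_eq: "transition_matrix n d E dl = mat n n (\<lambda>(u, v). p u v)"
  by (simp add: transition_matrix_def walk_kernel_def)

text \<open>The self-loops keep every eigenvalue above -1, so a positive \<open>gap\<close> makes
  \<open>abs_gap\<close> positive. If \<open>d \<le> dl\<close>, they make all eigenvalues
  nonnegative, and \<open>gap\<close> itself controls the absolute values.\<close>

lemma contracting_gaps:
  assumes "0 < gap n d E dl"
  shows "0 < abs_gap n d E dl" "abs_gap n d E dl \<le> 1" "contracting_kernel n p (1 - abs_gap n d E dl)"
    and "d \<le> dl \<Longrightarrow> gap n d E dl \<le> 1" "d \<le> dl \<Longrightarrow> contracting_kernel n p (1 - gap n d E dl)"
proof -
  obtain e I where I: "I \<subseteq> {..<n}" "card I = n - 1"
    and ev: "eigenvalues_mset (mat n n (\<lambda>(u, v). p u v)) = add_mset 1 (image_mset e (mset_set I))"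
    and e1: "\<And>i. i \<in> I \<Longrightarrow> \<bar>e i\<bar> \<le> 1"
    and eg: "\<And>i. i \<in> I \<Longrightarrow> \<exists>g. ip g g = 1 \<and> ip g (walk g) = e i"
    and contr: "\<And>g \<rho>. \<forall>i\<in>I. \<bar>e i\<bar> \<le> \<rho> \<Longrightarrow> \<rho> < 1 \<Longrightarrow> (\<Sum>u<n. g u) = 0 \<Longrightarrow>
       ip (walk g) (walk g) \<le> \<rho>\<^sup>2 * ip g g"
    using eigenvalue_structure by blast
  have fin: "finite I" using I(1) finite_subset by blast
  have "I \<noteq> {}" using I(2) n_ge_2 by auto
  then have ne: "image_mset e (mset_set I) \<noteq> {#}" "image_mset (\<lambda>i. \<bar>e i\<bar>) (mset_set I) \<noteq> {#}"
    using fin by (auto simp: mset_set_empty_iff)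
  define l where "l = second_largest (add_mset 1 (image_mset e (mset_set I)))"
  define l' where "l' = second_largest (add_mset 1 (image_mset (\<lambda>i. \<bar>e i\<bar>) (mset_set I)))"
  have gap: "gap n d E dl = 1 - l" by (simp add: gap_def transition_matrix_eq ev l_def)
  have abs_gap: "abs_gap n d E dl = 1 - l'"
    by (simp add: abs_gap_def transition_matrix_eq ev l'_def image_mset.compositionality o_def)
  have l1: "l < 1" using assms gap by simp
  have "l \<in># image_mset e (mset_set I)" unfolding l_def
    by (rule second_largest_add_max(1)[OF ne(1)]) (use e1 fin in \<open>auto simp: abs_le_iff\<close>)
  then have l_mem: "\<exists>i\<in>I. l = e i" using fin by auto
  have l_max: "e i \<le> l" if "i \<in> I" for i unfolding l_def
    by (rule second_largest_add_max(2)[OF ne(1)]) (use e1 fin that in \<open>auto simp: abs_le_iff\<close>)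
  have "l' \<in># image_mset (\<lambda>i. \<bar>e i\<bar>) (mset_set I)" unfolding l'_def
    by (rule second_largest_add_max(1)[OF ne(2)]) (use e1 fin in auto)
  then have l'_mem: "\<exists>i\<in>I. l' = \<bar>e i\<bar>" using fin by auto
  have l'_max: "\<bar>e i\<bar> \<le> l'" if "i \<in> I" for i unfolding l'_def
    by (rule second_largest_add_max(2)[OF ne(2)]) (use e1 fin that in auto)
  have lower: "2 * (real dl / real (d + dl)) - 1 \<le> e i" if "i \<in> I" for i
  proof -
    obtain g where "ip g g = 1" "ip g (walk g) = e i" using eg[OF \<open>i \<in> I\<close>] by blast
    then show ?thesis using ip_walk_ge[of "real dl / real (d + dl)" g] p_diag by simp
  qed
  have "\<bar>e i\<bar> < 1" if "i \<in> I" for i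
  proof -
    have "0 < real dl / real (d + dl)" using dl_pos by simp
    then show ?thesis using lower[OF that] l_max[OF that] l1 by linarith
  qed
  then show pos: "0 < abs_gap n d E dl" using abs_gap l'_mem by auto
  show "abs_gap n d E dl \<le> 1" using abs_gap l'_mem by auto
  show "contracting_kernel n p (1 - abs_gap n d E dl)"
  proof unfold_locales
    show "ip (walk g) (walk g) \<le> (1 - abs_gap n d E dl)\<^sup>2 * ip g g" if "(\<Sum>u<n. g u) = 0" for g
      using contr[of l' g] l'_max that pos abs_gap by simp
  qed (use pos abs_gap l'_mem in auto)
  assume "d \<le> dl"
  then have nonneg: "0 \<le> e i" if "i \<in> I" for i
  proof -
    have "1 \<le> 2 * (real dl / real (d + dl))" using \<open>d \<le> dl\<close> d_pos by (simp add: field_simps)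
    then show ?thesis using lower[OF that] by linarith
  qed
  show "gap n d E dl \<le> 1" using gap l_mem nonneg by auto
  show "contracting_kernel n p (1 - gap n d E dl)"
  proof unfold_locales
    show "ip (walk g) (walk g) \<le> (1 - gap n d E dl)\<^sup>2 * ip g g" if "(\<Sum>u<n. g u) = 0" for g
      using contr[of l g] l_max nonneg that l1 gap by simp
  qed (use gap l1 l_mem nonneg in auto)
qed

lemma lazy_if: "d \<le> dl \<Longrightarrow> lazy_kernel n p"
  by unfold_locales (simp add: p_diag[symmetric] field_simps, use d_pos in simp)

text \<open>\<open>E\<close> holds both orientations of every edge, as does the double sum of the
  Dirichlet form; this accounts for the factor 2.\<close>

lemma edge_energy_le: "(\<Sum>(a, b)\<in>E. (h a - h b)\<^sup>2) \<le> 2 * real (d + dl) * ip h (lap h)"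
proof -
  have "(\<Sum>(a, b)\<in>E. (h a - h b)\<^sup>2) = real (d + dl) * (\<Sum>(a, b)\<in>E. p a b * (h a - h b)\<^sup>2)"
    unfolding sum_distrib_left using d_pos by (intro sum.cong refl) (auto simp: walk_kernel_def)
  also have "\<dots> \<le> real (d + dl) * (\<Sum>(a, b)\<in>{..<n} \<times> {..<n}. p a b * (h a - h b)\<^sup>2)"
    using reg by (intro mult_left_mono sum_mono2)
      (auto simp: regular_graph_def intro!: mult_nonneg_nonneg p_nonneg)
  also have "(\<Sum>(a, b)\<in>{..<n} \<times> {..<n}. p a b * (h a - h b)\<^sup>2) = 2 * ip h (lap h)"
    unfolding dirichlet_form by (simp add: sum.cartesian_product)
  finally show ?thesis by (simp add: algebra_simps)
qed

text \<open>Otherwise the indicator of the component of \<open>s\<close>, minus its mean, is fixed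
  by the walk, has sum zero and does not vanish, which contradicts the contraction.\<close>

lemma connected:
  assumes "contracting_kernel n p \<rho>" and s: "s < n" and v: "v < n"
  shows "(s, v) \<in> E\<^sup>*"
proof (rule ccontr)
  assume not: "(s, v) \<notin> E\<^sup>*"
  interpret contracting_kernel n p \<rho> by fact
  define i where "i u = (if (s, u) \<in> E\<^sup>* then 1 else 0 :: real)" for u
  define m where "m = (\<Sum>u<n. i u) / real n"
  define g where "g u = i u - m" for u
  have const: "i w = i u" if "(u, w) \<in> E" for u w
    using that E_sym[OF that] unfolding i_def by (meson rtrancl.rtrancl_into_rtrancl)
  have walk_i: "walk i u = i u" if "u < n" for u
  proof -
    have "(\<Sum>w\<in>E `` {u}. i w) = (\<Sum>w\<in>E `` {u}. i u)"
      by (intro sum.cong refl) (simp add: const)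
    then show ?thesis
      unfolding walk_def walk_kernel_apply[OF that] using degree[OF that] d_pos by (simp add: field_simps)
  qed
  have sum_g: "(\<Sum>u<n. g u) = 0" using n_pos by (simp add: g_def m_def sum_subtractf)
  have "walk g u = g u" if "u < n" for u
    using that walk_i by (simp add: g_def[abs_def] walk_diff walk_const)
  then have "ip (walk g) (walk g) = ip g g" by (intro ip_cong) auto
  then have "ip g g \<le> \<rho>\<^sup>2 * ip g g" using contraction[OF sum_g] by simp
  moreover have "\<rho>\<^sup>2 < 1" using power_strict_mono[of \<rho> 1 2] rho_nonneg rho_less_1 by simp
  ultimately have "ip g g = 0"
    using ip_self_nonneg[of g] mult_strict_right_mono[of "\<rho>\<^sup>2" 1 "ip g g"] by (cases "ip g g = 0") auto
  then have "g v * g v = 0"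
    unfolding ip_def using v by (subst (asm) sum_nonneg_eq_0_iff) auto
  then have "m = 0" using not by (simp add: g_def i_def)
  moreover have "i s \<le> (\<Sum>u<n. i u)" using s by (intro member_le_sum) (auto simp: i_def)
  ultimately show False using n_pos by (simp add: m_def i_def)
qed

text \<open>On a shortest path, nodes at distance 3 or more along the path have disjoint
  neighbourhoods of size \<open>d\<close>, which limits the length. Cauchy-Schwarz along the path
  bounds the squared difference of the end values by the energy, with one \<open>l\<close> for all
  \<open>h\<close>.\<close>

lemma short_path:
  assumes "(s, v) \<in> E\<^sup>*" "s < n"
  shows "\<exists>l. l * d \<le> 3 * n \<and> (\<forall>h :: nat \<Rightarrow> real. (h s - h v)\<^sup>2 \<le> real l * (\<Sum>(a, b)\<in>E. (h a - h b)\<^sup>2))"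
proof -
  define l where "l = (LEAST k. (s, v) \<in> E ^^ k)"
  have "\<exists>k. (s, v) \<in> E ^^ k" using assms(1) rtrancl_power by blast
  then have "(s, v) \<in> E ^^ l" unfolding l_def by (rule LeastI_ex)
  then obtain q where q: "q 0 = s" "q l = v" "\<And>i. i < l \<Longrightarrow> (q i, q (Suc i)) \<in> E"
    unfolding relpow_fun_conv by blast
  have least: "l \<le> k" if "(s, v) \<in> E ^^ k" for k unfolding l_def using that by (rule Least_le)
  have seg: "(q i, q j) \<in> E ^^ (j - i)" if "i \<le> j" "j \<le> l" for i j
    unfolding relpow_fun_conv by (rule exI[of _ "\<lambda>k. q (i + k)"]) (use that q(3) in auto)
  have shortcut: "j - i \<le> k" if "(q i, q j) \<in> E ^^ k" "i \<le> j" "j \<le> l" for i j k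
  proof -
    have "(s, q i) \<in> E ^^ i" using seg[of 0 i] that q by simp
    moreover have "(q j, v) \<in> E ^^ (l - j)" using seg[of j l] that q by simp
    ultimately have "(s, v) \<in> E ^^ (i + k + (l - j))" using that(1) by (auto simp: relpow_add)
    from least[OF this] show ?thesis using that by simp
  qed
  have qn: "q i < n" if "i \<le> l" for i
  proof (cases i)
    case 0
    then show ?thesis using q assms by simp
  next
    case (Suc j)
    then show ?thesis using q(3)[of j] E_less that by auto
  qed
  have inj: "inj_on q {..l}"
  proof (rule linorder_inj_onI')
    fix i j assume "i \<in> {..l}" "j \<in> {..l}" "i < j"
    then show "q i \<noteq> q j" using shortcut[of i j 0] by auto
  qed
  \<comment> \<open>Every third node of the path: a common neighbour of two of them would be a
    shortcut of length 2.\<close>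
  define J where "J = {i. 3 * i \<le> l}"
  have J: "J = {..l div 3}" by (auto simp: J_def)
  have disj: "E `` {q (3 * i)} \<inter> E `` {q (3 * j)} = {}" if "i \<in> J" "j \<in> J" "i < j" for i j
  proof (rule ccontr)
    assume "\<not> ?thesis"
    then obtain w where "(q (3 * i), w) \<in> E" "(q (3 * j), w) \<in> E" by auto
    then have "(q (3 * i), q (3 * j)) \<in> E ^^ 2" using E_sym by (auto simp: numeral_2_eq_2)
    from shortcut[OF this] show False using that by (auto simp: J_def)
  qed
  then have disj': "E `` {q (3 * i)} \<inter> E `` {q (3 * j)} = {}" if "i \<in> J" "j \<in> J" "i \<noteq> j" for i j
    using that by (metis Int_commute linorder_neqE_nat)
  have "card J * d = (\<Sum>i\<in>J. card (E `` {q (3 * i)}))"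
    using qn degree by (simp add: J_def)
  also have "\<dots> = card (\<Union>i\<in>J. E `` {q (3 * i)})"
    by (rule card_UN_disjoint[symmetric]) (use J finite_nbrs disj' in auto)
  also have "\<dots> \<le> card {..<n}" by (intro card_mono) (auto simp: E_less)
  finally have "(l div 3 + 1) * d \<le> n" by (simp add: J)
  moreover have "l * d \<le> 3 * (l div 3 + 1) * d" by (intro mult_right_mono) auto
  ultimately have ld: "l * d \<le> 3 * n" by linarith
  have "(h s - h v)\<^sup>2 \<le> real l * (\<Sum>(a, b)\<in>E. (h a - h b)\<^sup>2)" for h :: "nat \<Rightarrow> real"
  proof -
    have "h s - h v = (\<Sum>i<l. h (q i) - h (q (Suc i)))"
      using sum_lessThan_telescope'[of "\<lambda>i. h (q i)" l] q by simp
    then have "(h s - h v)\<^sup>2 \<le> real l * (\<Sum>i<l. (h (q i) - h (q (Suc i)))\<^sup>2)"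
      using sum_Cauchy_Schwarz[of "\<lambda>_. 1" "\<lambda>i. h (q i) - h (q (Suc i))" "{..<l}"] by simp
    \<comment> \<open>The path visits no node twice, so its edges are distinct and each counts
      once.\<close>
    also have "(\<Sum>i<l. (h (q i) - h (q (Suc i)))\<^sup>2) = (\<Sum>(a, b)\<in>(\<lambda>i. (q i, q (Suc i))) ` {..<l}. (h a - h b)\<^sup>2)"
      by (subst sum.reindex) (auto simp: inj_on_def intro: inj_onD[OF inj])
    also have "\<dots> \<le> (\<Sum>(a, b)\<in>E. (h a - h b)\<^sup>2)"
      by (intro sum_mono2 finite_E) (use q(3) in auto)
    finally show ?thesis by (simp add: mult_left_mono)
  qed
  with ld show ?thesis by blast
qed

text \<open>The truncated Green function \<open>h\<close> satisfies \<open>h s = H\<close>, and its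
  energy is at most \<open>H\<close> because \<open>lap h\<close> telescopes. Along a shortest path
  to a node with \<open>h v \<le> 0\<close>, H^2 is at most a constant times the energy, hence times
  \<open>H\<close>; dividing by \<open>H\<close> bounds it.\<close>

lemma green_function_le:
  assumes lz: "d \<le> dl" and con: "contracting_kernel n p \<rho>" and s: "s < n"
  shows "(\<Sum>j<N. ip (\<lambda>u. point s u - 1 / real n) ((walk ^^ j) (\<lambda>u. point s u - 1 / real n)))
      \<le> 6 * real n * real (d + dl) / real d"
proof -
  interpret lazy_kernel n p using lz by (rule lazy_if)
  define z where "z = (\<lambda>u. point s u - 1 / real n)"
  define h where "h = (\<lambda>u. \<Sum>j<N. (walk ^^ j) z u)"
  define H where "H = (\<Sum>j<N. ip z ((walk ^^ j) z))"
  have sum_z: "(\<Sum>u<n. z u) = 0" using s n_pos by (simp add: z_def point_def sum_subtractf)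
  have sum_h: "(\<Sum>u<n. h u) = 0"
    unfolding h_def by (subst sum.swap) (simp add: sum_walk_pow sum_z)
  have ip_h: "ip g h = (\<Sum>j<N. ip g ((walk ^^ j) z))" for g
    unfolding h_def ip_def sum_distrib_left by (rule sum.swap)
  have pos: "0 \<le> ip z ((walk ^^ j) z)" for j using ip_walk_pow_lap_pow_nonneg[of z j 0] by simp
  have zh: "ip z h = H" by (simp add: ip_h H_def)
  have "ip z h = ip (point s) h - (\<Sum>u<n. h u) / real n"
    by (simp add: z_def ip_def left_diff_distrib sum_subtractf sum_divide_distrib)
  then have hs: "h s = H" using zh sum_h ip_point[OF s] by simp
  have "lap h = (\<lambda>u. z u - (walk ^^ N) z u)"
  proof
    fix u
    have "lap h u = (\<Sum>j<N. (walk ^^ j) z u - (walk ^^ Suc j) z u)"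
      by (simp add: lap_def h_def walk_sum sum_subtractf)
    then show "lap h u = z u - (walk ^^ N) z u"
      using sum_lessThan_telescope'[of "\<lambda>j. (walk ^^ j) z u" N] by simp
  qed
  then have "ip h (lap h) = H - ip h ((walk ^^ N) z)"
    using zh by (simp add: ip_diff_right ip_commute)
  also have "ip h ((walk ^^ N) z) = (\<Sum>j<N. ip z ((walk ^^ (N + j)) z))"
    by (simp add: ip_commute[of h] ip_h ip_walk_pow funpow_add)
  finally have energy: "ip h (lap h) \<le> H" using pos by (simp add: sum_nonneg)
  \<comment> \<open>The values of \<open>h\<close> add up to 0, so they cannot all be
    positive.\<close>
  have "\<exists>v<n. h v \<le> 0"
  proof (rule ccontr)
    assume "\<not> ?thesis"
    then have "0 < (\<Sum>u<n. h u)" using n_pos by (intro sum_pos) auto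
    then show False using sum_h by simp
  qed
  then obtain v where v: "v < n" "h v \<le> 0" by blast
  obtain l where l: "l * d \<le> 3 * n" "(h s - h v)\<^sup>2 \<le> real l * (\<Sum>(a, b)\<in>E. (h a - h b)\<^sup>2)"
    using short_path[OF connected[OF con s v(1)] s] by blast
  have H0: "0 \<le> H" unfolding H_def using pos by (simp add: sum_nonneg)
  have "H\<^sup>2 \<le> (h s - h v)\<^sup>2" using v H0 hs by (intro power_mono) auto
  also note l(2)
  also have "real l * (\<Sum>(a, b)\<in>E. (h a - h b)\<^sup>2) \<le> real l * (2 * real (d + dl) * ip h (lap h))"
    using edge_energy_le by (intro mult_left_mono) auto
  also have "\<dots> \<le> real l * (2 * real (d + dl) * H)" using energy by (intro mult_left_mono) auto
  finally have "H * H \<le> (2 * real l * real (d + dl)) * H" by (simp add: power2_eq_square mult_ac)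
  then have "H \<le> 2 * real l * real (d + dl)"
    using H0 mult_le_cancel_right_pos[of H H "2 * real l * real (d + dl)"] by (cases "H = 0") auto
  also have "\<dots> \<le> 6 * real n * real (d + dl) / real d"
  proof -
    have "real l * real d \<le> 3 * real n" using l(1) by (metis of_nat_le_iff of_nat_mult of_nat_numeral)
    then have "real l \<le> 3 * real n / real d" using d_pos by (simp add: field_simps)
    then have "2 * real l * real (d + dl) \<le> 2 * (3 * real n / real d) * real (d + dl)"
      by (intro mult_right_mono) auto
    then show ?thesis by simp
  qed
  finally show ?thesis by (simp add: H_def z_def)
qed

end

section \<open>Drift summed over all times\<close>

lemma sqrt_mult_power_le_half:
  assumes n: "2 \<le> n" and \<mu>: "0 < \<mu>" "\<mu> \<le> 1"
  defines "T \<equiv> nat \<lceil>2 * ln (real n) / \<mu>\<rceil>"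
  shows "sqrt (real n) * (1 - \<mu>) ^ T \<le> 1 / 2" "real T \<le> 4 * (ln (real n) / \<mu>)" "1 / 2 \<le> ln (real n) / \<mu>"
proof -
  have "ln (1 / 2 :: real) \<le> - (1 / 2)" using ln_le_minus_one[of "1 / 2 :: real"] by simp
  then have "1 / 2 \<le> ln (2 :: real)" by (simp add: ln_div)
  also have "\<dots> \<le> ln (real n)" using n by simp
  finally have ln_n: "1 / 2 \<le> ln (real n)" .
  also have "\<dots> \<le> ln (real n) / \<mu>" using \<mu> ln_n by (simp add: field_simps)
  finally show half: "1 / 2 \<le> ln (real n) / \<mu>" .
  \<comment> \<open>\<open>T\<close> is chosen so that (1 - \<mu>)^T is at most 1/n^2, which beats
    \<open>sqrt (real n)\<close> with at least a factor 2 to spare. The 1 added by rounding up is at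
    most twice the quantity bounded below by \<open>half\<close>.\<close>
  have T_ge: "2 * ln (real n) / \<mu> \<le> real T" unfolding T_def by linarith
  have "real T \<le> 2 * ln (real n) / \<mu> + 1" unfolding T_def using half by linarith
  then show "real T \<le> 4 * (ln (real n) / \<mu>)" using half by linarith
  have "(1 - \<mu>) ^ T \<le> exp (- \<mu>) ^ T"
    using \<mu> exp_ge_add_one_self[of "- \<mu>"] by (intro power_mono) auto
  also have "\<dots> = exp (- (real T * \<mu>))" by (simp add: exp_of_nat_mult[symmetric])
  also have "\<dots> \<le> exp (- (2 * ln (real n)))" using T_ge \<mu> by (simp add: field_simps)
  also have "\<dots> = 1 / (real n)\<^sup>2"
    using n by (simp add: exp_minus exp_double inverse_eq_divide)
  finally have pow: "(1 - \<mu>) ^ T \<le> 1 / (real n)\<^sup>2" .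
  have "sqrt (real n) \<le> real n" using n by (intro real_le_lsqrt) (auto simp: power2_eq_square)
  then have "sqrt (real n) * (1 - \<mu>) ^ T \<le> real n * (1 / (real n)\<^sup>2)"
    using pow \<mu> by (intro mult_mono) auto
  also have "\<dots> \<le> 1 / 2" using n by (simp add: power2_eq_square field_simps)
  finally show "sqrt (real n) * (1 - \<mu>) ^ T \<le> 1 / 2" .
qed

context balancing_graph
begin

text \<open>Only the first \<open>T\<close> terms count, up to a factor 2. Each is at most 2 in
  general and at most \<open>1 / sqrt (real (Suc k))\<close> for a lazy walk.\<close>

lemma sum_drift_le_spectral:
  assumes con: "contracting_kernel n p (1 - \<mu>)" and \<mu>: "\<mu> \<le> 1" and u: "u < n"
  shows "(\<Sum>k<t. drift u k) \<le> 16 * (ln (real n) / \<mu>)"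
    and "d \<le> dl \<Longrightarrow> (\<Sum>k<t. drift u k) \<le> 8 * sqrt (ln (real n) / \<mu>)"
proof -
  interpret contracting_kernel n p "1 - \<mu>" by fact
  have \<mu>0: "0 < \<mu>" using rho_less_1 by simp
  define T where "T = nat \<lceil>2 * ln (real n) / \<mu>\<rceil>"
  note T = sqrt_mult_power_le_half[OF n_ge_2 \<mu>0 \<mu>, folded T_def]
  have le: "(\<Sum>k<t. drift u k) \<le> 2 * (\<Sum>k<T. drift u k)" by (rule sum_drift_le[OF u T(1)])
  have "(\<Sum>k<T. drift u k) \<le> (\<Sum>k<T. 2)" using drift_le_2[OF u] by (intro sum_mono) auto
  then show "(\<Sum>k<t. drift u k) \<le> 16 * (ln (real n) / \<mu>)" using le T(2) by simp
  assume "d \<le> dl"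
  then interpret lazy_kernel n p by (rule lazy_if)
  have "(\<Sum>k<T. drift u k) \<le> (\<Sum>k<T. 1 / sqrt (real (Suc k)))"
    by (intro sum_mono drift_le_inverse_sqrt[OF u])
  also have "\<dots> \<le> 2 * sqrt (real T)" by (rule sum_inverse_sqrt_le)
  also have "\<dots> \<le> 2 * sqrt (4 * (ln (real n) / \<mu>))"
    using T(2) by (intro mult_left_mono real_sqrt_le_mono) auto
  also have "\<dots> = 4 * sqrt (ln (real n) / \<mu>)" by (simp only: real_sqrt_mult real_sqrt_four)
  finally show "(\<Sum>k<t. drift u k) \<le> 8 * sqrt (ln (real n) / \<mu>)" using le by simp
qed

text \<open>The two decay bounds cross at \<open>k\<close> of order \<open>n\<close>. Up to
  \<open>n\<close> the inverse square roots sum to order \<open>sqrt (real n)\<close>; beyond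
  \<open>n\<close> so does the tail of \<open>n / (k * sqrt k)\<close>.\<close>

lemma sum_drift_le_sqrt_nodes:
  assumes con: "contracting_kernel n p \<rho>" and lz: "d \<le> dl" and c: "0 \<le> c" "real dl \<le> c * real d" and u: "u < n"
  shows "(\<Sum>k<t. drift u k) \<le> 18 * (1 + c) * sqrt (real n)"
proof -
  interpret lazy_kernel n p using lz by (rule lazy_if)
  define R where "R = 6 * real n * (1 + c)"
  have "6 * real n * real (d + dl) / real d \<le> R"
  proof -
    have "real (d + dl) / real d \<le> 1 + c" using c d_pos by (simp add: field_simps)
    from mult_left_mono[OF this, of "6 * real n"] show ?thesis by (simp add: R_def)
  qed
  then have R: "(\<Sum>j<N. ip (\<lambda>v. point u v - 1 / real n) ((walk ^^ j) (\<lambda>v. point u v - 1 / real n))) \<le> R" for N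
    using green_function_le[OF lz con u, of N] by linarith
  have "sqrt (8 * real n * R) \<le> 7 * real n * (1 + c)"
  proof (rule real_le_lsqrt)
    \<comment> \<open>48 is 8 times the 6 in \<open>R\<close>; 49 is the next square.\<close>
    have "48 * (1 + c) \<le> 49 * (1 + c)\<^sup>2" using c(1) by (simp add: power2_eq_square algebra_simps)
    from mult_left_mono[OF this, of "(real n)\<^sup>2"]
    show "8 * real n * R \<le> (7 * real n * (1 + c))\<^sup>2"
      by (simp add: R_def power_mult_distrib) (simp add: power2_eq_square mult_ac)
  qed (use c in auto)
  then have tail: "drift u (n + Suc k) \<le> 7 * real n * (1 + c) * (1 / (real (n + Suc k) * sqrt (real (n + Suc k))))" for k
    using drift_le_three_halves[OF u _ R, of "n + Suc k"] n_ge_2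
      divide_right_mono[of "sqrt (8 * real n * R)" "7 * real n * (1 + c)" "real (n + Suc k) * sqrt (real (n + Suc k))"]
    by simp
  have "(\<Sum>k<t. drift u k) \<le> (\<Sum>k<Suc n + t. drift u k)"
    by (intro sum_mono2) (auto simp: drift_nonneg)
  also have "\<dots> = (\<Sum>k<Suc n. drift u k) + (\<Sum>k<t. drift u (n + Suc k))"
    by (induction t) (auto simp: add.assoc)
  also have "(\<Sum>k<Suc n. drift u k) \<le> 4 * sqrt (real n)"
  proof -
    have "(\<Sum>k<Suc n. drift u k) \<le> (\<Sum>k<Suc n. 1 / sqrt (real (Suc k)))"
      by (intro sum_mono drift_le_inverse_sqrt[OF u])
    also have "\<dots> \<le> 2 * sqrt (real (Suc n))" by (rule sum_inverse_sqrt_le)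
    also have "\<dots> \<le> 2 * sqrt (4 * real n)" using n_pos by (intro mult_left_mono real_sqrt_le_mono) auto
    finally show ?thesis by (simp add: real_sqrt_mult)
  qed
  also have "(\<Sum>k<t. drift u (n + Suc k)) \<le> 14 * (1 + c) * sqrt (real n)"
  proof -
    have "(\<Sum>k<t. drift u (n + Suc k))
        \<le> 7 * real n * (1 + c) * (\<Sum>k<t. 1 / (real (n + Suc k) * sqrt (real (n + Suc k))))"
      unfolding sum_distrib_left by (intro sum_mono tail)
    also have "\<dots> \<le> 7 * real n * (1 + c) * (2 / sqrt (real n))"
    proof (rule mult_left_mono)
      have "0 \<le> 2 / sqrt (real (n + t))" by simp
      with sum_three_halves_le[OF n_pos, of t]
      show "(\<Sum>k<t. 1 / (real (n + Suc k) * sqrt (real (n + Suc k)))) \<le> 2 / sqrt (real n)" by linarith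
    qed (use c(1) in simp)
    also have "\<dots> = 14 * (1 + c) * (real n / sqrt (real n))" by simp
    finally show ?thesis by (simp only: real_div_sqrt of_nat_0_le_iff)
  qed
  also have "4 * sqrt (real n) + 14 * (1 + c) * sqrt (real n) \<le> 18 * (1 + c) * sqrt (real n)"
    using c(1) by (simp add: algebra_simps)
  finally show ?thesis by simp
qed

end

section \<open>Cumulatively fair balancers\<close>

locale fair_run = balancing_graph +
  fixes \<delta> :: real and x :: "nat \<Rightarrow> nat \<Rightarrow> nat" and f :: "nat \<Rightarrow> edge \<Rightarrow> nat" and c :: real
  assumes run: "balancing_run n E dl x f" and fair: "cumulatively_fair \<delta> n d E dl x f"
    and \<delta>_nonneg: "0 \<le> \<delta>" and dl_le: "real dl \<le> c * real d" and c_nonneg: "0 \<le> c"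
begin

definition out :: "nat \<Rightarrow> nat \<Rightarrow> real" where
  "out t u = (\<Sum>v\<in>E `` {u}. real (f t (Orig u v)))"

definition loops :: "nat \<Rightarrow> nat \<Rightarrow> real" where
  "loops t u = (\<Sum>i<dl. real (f t (Loop u i)))"

definition avg :: "nat \<Rightarrow> nat \<Rightarrow> real" where
  "avg t u = out t u / real d"

text \<open>
  The excess of the load over what \<open>u\<close> would hold if self-loops received as much as its original
  edges do on average; it may be negative.
\<close>
definition rest :: "nat \<Rightarrow> nat \<Rightarrow> real" where
  "rest t u = real (x t u) - real (d + dl) * avg t u"

definition dev :: "nat \<Rightarrow> nat \<Rightarrow> nat \<Rightarrow> real" where
  "dev t u v = real (cumulative_flow f t (Orig u v)) - (\<Sum>\<tau>=1..t. avg \<tau> u)"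

text \<open>The \<psi> of the overview: deviations of the flows entering \<open>v\<close>. By
  symmetry of \<open>E\<close> the neighbours of \<open>v\<close> are the sources of these
  edges.\<close>

definition indev :: "nat \<Rightarrow> nat \<Rightarrow> real" where
  "indev t v = (\<Sum>u\<in>E `` {v}. dev t u v)"

lemma orig_edges_image: "orig_edges E u = Orig u ` (E `` {u})"
  by (auto simp: orig_edges_def)

text \<open>The maps \<open>k\<close> and \<open>l\<close> cover two cases at once: original edges
  with a fixed source and original edges with a fixed target.\<close>

lemma sum_edges:
  fixes h :: "edge \<Rightarrow> nat"
  assumes "finite A"
  shows "(\<Sum>e\<in>(\<lambda>w. Orig (k w) (l w)) ` A \<union> {Loop u i | i. i < dl}. h e)
    = (\<Sum>e\<in>(\<lambda>w. Orig (k w) (l w)) ` A. h e) + (\<Sum>i<dl. h (Loop u i))"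
proof -
  have "{Loop u i | i. i < dl} = Loop u ` {..<dl}" by auto
  moreover have "(\<Sum>e\<in>Loop u ` {..<dl}. h e) = (\<Sum>i<dl. h (Loop u i))"
    by (subst sum.reindex) (auto simp: inj_on_def)
  ultimately show ?thesis using assms by (subst sum.union_disjoint) auto
qed

lemma load_eq: "1 \<le> t \<Longrightarrow> u < n \<Longrightarrow> real (x t u) = out t u + loops t u"
proof -
  assume "1 \<le> t" "u < n"
  then have "x t u = (\<Sum>e\<in>all_edges E dl u. f t e)" using run by (simp add: balancing_run_def)
  also have "\<dots> = (\<Sum>v\<in>E `` {u}. f t (Orig u v)) + (\<Sum>i<dl. f t (Loop u i))"
    unfolding all_edges_def orig_edges_image
    using sum_edges[OF finite_nbrs, where k = "\<lambda>_. u" and l = "\<lambda>w. w"]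
    by (simp add: sum.reindex inj_on_def)
  finally show ?thesis by (simp add: out_def loops_def)
qed

lemma load_Suc_eq:
  "1 \<le> t \<Longrightarrow> v < n \<Longrightarrow> real (x (t + 1) v) = (\<Sum>u\<in>E `` {v}. real (f t (Orig u v))) + loops t v"
proof -
  assume tv: "1 \<le> t" "v < n"
  have "{e \<in> (\<Union>u<n. all_edges E dl u). target e = v} = (\<lambda>u. Orig u v) ` (E `` {v}) \<union> {Loop v i | i. i < dl}"
    using tv(2) by (auto simp: all_edges_def orig_edges_def E_less image_iff dest: E_sym)
  then have "x (t + 1) v = (\<Sum>e\<in>(\<lambda>u. Orig u v) ` (E `` {v}) \<union> {Loop v i | i. i < dl}. f t e)"
    using run tv by (simp add: balancing_run_def)
  also have "\<dots> = (\<Sum>u\<in>E `` {v}. f t (Orig u v)) + (\<Sum>i<dl. f t (Loop v i))"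
    using sum_edges[OF finite_nbrs, where k = "\<lambda>w. w" and l = "\<lambda>_. v"]
    by (simp add: sum.reindex inj_on_def)
  finally show ?thesis by (simp add: loops_def)
qed

text \<open>The accumulated averages are the mean of the cumulative flows over the \<open>d\<close>
  original edges at \<open>u\<close>, and each of these is within \<open>\<delta>\<close> of the
  flow to \<open>v\<close>. Fairness speaks of steps from 1 on, so \<open>t = 0\<close> is
  separate.\<close>

lemma dev_le:
  assumes "(u, v) \<in> E"
  shows "\<bar>dev t u v\<bar> \<le> \<delta>"
proof (cases "t = 0")
  case True
  then show ?thesis using \<delta>_nonneg by (simp add: dev_def cumulative_flow_def)
next
  case False
  define F where "F w = real (cumulative_flow f t (Orig u w))" for w
  have u: "u < n" using assms E_less by blast
  have diff: "\<bar>F v - F w\<bar> \<le> \<delta>" if "w \<in> E `` {u}" for w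
    using fair False u assms that unfolding cumulatively_fair_def F_def orig_edges_image by auto
  have "(\<Sum>\<tau>=1..t. avg \<tau> u) = (\<Sum>w\<in>E `` {u}. F w) / real d"
    unfolding avg_def out_def F_def cumulative_flow_def of_nat_sum sum_divide_distrib[symmetric]
    by (subst sum.swap) simp
  then have "dev t u v = F v - (\<Sum>w\<in>E `` {u}. F w) / real d" by (simp add: dev_def F_def)
  also have "\<dots> = (\<Sum>w\<in>E `` {u}. F v - F w) / real d"
    using degree[OF u] d_pos by (simp add: sum_subtractf diff_divide_distrib)
  finally have "\<bar>dev t u v\<bar> \<le> (\<Sum>w\<in>E `` {u}. \<bar>F v - F w\<bar>) / real d"
    by (simp add: divide_right_mono)
  also have "\<dots> \<le> (\<Sum>w\<in>E `` {u}. \<delta>) / real d"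
    using diff by (intro divide_right_mono sum_mono) auto
  finally show ?thesis using degree[OF u] d_pos by simp
qed

lemma indev_le:
  assumes "v < n"
  shows "\<bar>indev t v\<bar> \<le> \<delta> * real d"
proof -
  have "\<bar>indev t v\<bar> \<le> (\<Sum>u\<in>E `` {v}. \<delta>)"
    unfolding indev_def by (intro order_trans[OF sum_abs] sum_mono dev_le) (auto intro: E_sym)
  then show ?thesis using degree[OF assms] by (simp add: mult.commute)
qed

text \<open>With \<open>s\<close> the remainder of the load modulo \<open>D\<close>, the guaranteed
  share of the original edges gives \<open>rest t u \<le> s\<close>. The guaranteed share of the
  loops caps \<open>out t u\<close> and gives
  \<open>real d * rest t u \<ge> - (real dl * s)\<close>.\<close>

lemma rest_le:
  assumes t: "1 \<le> t" and u: "u < n"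
  shows "\<bar>rest t u\<bar> \<le> (1 + c)\<^sup>2 * real d"
proof -
  define q where "q = x t u div (d + dl)"
  define D where "D = real (d + dl)"
  have D: "0 < D" "D \<le> (1 + c) * real d" using d_pos dl_le by (auto simp: D_def algebra_simps)
  define s where "s = real (x t u) - D * real q"
  have "(d + dl) * q \<le> x t u" "x t u < (d + dl) * q + (d + dl)"
    using d_pos dividend_less_times_div[of "d + dl" "x t u"] by (auto simp: q_def)
  then have "real ((d + dl) * q) \<le> real (x t u)" "real (x t u) < real ((d + dl) * q + (d + dl))"
    by (simp_all only: of_nat_le_iff of_nat_less_iff)
  then have s: "0 \<le> s" "s \<le> D" by (auto simp: s_def D_def)
  have ge: "q \<le> f t e" if "e \<in> all_edges E dl u" for e
    using fair t u that by (auto simp: cumulatively_fair_def q_def)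
  have "(\<Sum>v\<in>E `` {u}. real q) \<le> out t u"
    unfolding out_def by (intro sum_mono) (auto intro!: ge simp: all_edges_def orig_edges_def)
  then have 1: "real d * real q \<le> out t u" using degree[OF u] by simp
  have "(\<Sum>i<dl. real q) \<le> loops t u"
    unfolding loops_def by (intro sum_mono) (auto intro!: ge simp: all_edges_def)
  then have 2: "real dl * real q \<le> loops t u" by simp
  have eq: "real d * rest t u = real d * real (x t u) - D * out t u"
    unfolding rest_def avg_def D_def[symmetric] using d_pos by (simp add: right_diff_distrib)
  have "D * (real d * real q) \<le> D * out t u" using 1 D by (intro mult_left_mono) auto
  then have "real d * rest t u \<le> real d * s" unfolding eq s_def by (simp add: algebra_simps)
  then have "rest t u \<le> s" using d_pos by simp
  then have up: "rest t u \<le> D" using s by simp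
  have "D * out t u \<le> D * (real (x t u) - real dl * real q)"
    using load_eq[OF t u] 2 D by (intro mult_left_mono) auto
  then have "- (real dl * s) \<le> real d * rest t u"
    unfolding eq s_def D_def by (simp add: algebra_simps)
  moreover have "real dl * s \<le> (c * real d) * D"
    using s dl_le by (intro mult_mono) auto
  ultimately have "real d * (- (c * D)) \<le> real d * rest t u" by (simp add: mult_ac)
  then have "- (c * D) \<le> rest t u" using d_pos by (simp only: mult_le_cancel_left_pos of_nat_0_less_iff)
  moreover have "0 \<le> c * D" using c_nonneg D by simp
  ultimately have "\<bar>rest t u\<bar> \<le> (1 + c) * D" using up D by (simp add: distrib_right)
  also have "\<dots> \<le> (1 + c) * ((1 + c) * real d)" using D c_nonneg by (intro mult_left_mono) auto
  finally show ?thesis by (simp add: power2_eq_square mult.assoc)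
qed

text \<open>The inflow over original edges is the sum of the neighbours' averages plus the increment
  of \<open>indev\<close>. Loops keep what is not sent, so the load changes by d^+ (P - I) applied
  to \<open>avg\<close>, plus this increment; finally d^+ times \<open>avg\<close> is the load minus
  \<open>rest\<close>.\<close>

lemma load_recurrence:
  assumes t: "1 \<le> t" and v: "v < n"
  shows "real (x (t + 1) v) = walk (\<lambda>u. real (x t u)) v + lap (rest t) v + (indev t v - indev (t - 1) v)"
proof -
  obtain t' where t': "t = Suc t'" using t by (cases t) auto
  have "dev t u v - dev (t - 1) u v = real (f t (Orig u v)) - avg t u" for u
    by (simp add: dev_def cumulative_flow_def t')
  then have dd: "indev t v - indev (t - 1) v = (\<Sum>u\<in>E `` {v}. real (f t (Orig u v))) - (\<Sum>u\<in>E `` {v}. avg t u)"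
    unfolding indev_def sum_subtractf[symmetric] by simp
  have "lap (rest t) v = lap (\<lambda>u. real (x t u)) v - real (d + dl) * lap (avg t) v"
    unfolding rest_def lap_def walk_diff walk_mult by (simp add: algebra_simps)
  also have "real (d + dl) * lap (avg t) v = real d * avg t v - (\<Sum>u\<in>E `` {v}. avg t u)"
    unfolding lap_def walk_def walk_kernel_apply[OF v] using d_pos by (simp add: field_simps)
  also have "real d * avg t v = out t v" using d_pos by (simp add: avg_def)
  finally show ?thesis
    using load_eq[OF t v] load_Suc_eq[OF t v] dd by (simp add: lap_def)
qed

text \<open>Every load at time \<open>t + 1\<close> is compared with the mean load \<open>m\<close>.
  The initial imbalance has decayed to at most 1, and the rest is at most the last
  \<open>indev\<close> plus the source bound \<open>W\<close> times the summed drift.\<close>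

lemma discrepancy_le:
  assumes con: "contracting_kernel n p (1 - \<mu>)"
    and t: "ln (discrepancy n (x 1) * real n) / \<mu> \<le> real t"
    and S: "\<And>u. u < n \<Longrightarrow> (\<Sum>k<t. drift u k) \<le> S"
  shows "discrepancy n (x (t + 1)) \<le> 2 * ((\<delta> + 1) * real d * (1 + (1 + c)\<^sup>2 * S))"
proof -
  interpret contracting_kernel n p "1 - \<mu>" by fact
  have \<mu>0: "0 < \<mu>" using rho_less_1 by simp
  define K where "K = discrepancy n (x 1)"
  define y where "y t u = real (x t u)" for t u
  define m where "m = (\<Sum>u<n. y 1 u) / real n"
  define W where "W = (1 + c)\<^sup>2 * ((\<delta> + 1) * real d)"
  have bounds: "Min (x t ` {..<n}) \<le> x t u" "x t u \<le> Max (x t ` {..<n})" if "u < n" for t u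
    using that by auto
  have m: "real (Min (x 1 ` {..<n})) \<le> m" "m \<le> real (Max (x 1 ` {..<n}))"
  proof -
    have "(\<Sum>u<n. real (Min (x 1 ` {..<n}))) \<le> (\<Sum>u<n. y 1 u)"
      using bounds(1) by (intro sum_mono) (auto simp: y_def)
    then show "real (Min (x 1 ` {..<n})) \<le> m" using n_pos by (simp add: m_def field_simps)
    have "(\<Sum>u<n. y 1 u) \<le> (\<Sum>u<n. real (Max (x 1 ` {..<n})))"
      using bounds(2) by (intro sum_mono) (auto simp: y_def)
    then show "m \<le> real (Max (x 1 ` {..<n}))" using n_pos by (simp add: m_def field_simps)
  qed
  have yK: "\<bar>y 1 u - m\<bar> \<le> K" if "u < n" for u
  proof -
    have "real (Min (x 1 ` {..<n})) \<le> y 1 u" "y 1 u \<le> real (Max (x 1 ` {..<n}))"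
      using bounds[OF that, of 1] by (simp_all add: y_def)
    then show ?thesis using m by (simp add: K_def discrepancy_def abs_le_iff)
  qed
  have decay: "(1 - \<mu>) ^ t * (sqrt (real n) * K) \<le> 1"
  \<comment> \<open>For \<open>K = 0\<close> the logarithm in the time bound says nothing, but the
    claim is trivial. Otherwise \<open>K\<close> is a positive integer, hence at least 1.\<close>
  proof (cases "K = 0")
    case False
    have "K = real_of_int (int (Max (x 1 ` {..<n})) - int (Min (x 1 ` {..<n})))"
      by (simp add: K_def discrepancy_def)
    moreover have "0 \<le> K" using yK[OF n_pos] by linarith
    ultimately have K1: "1 \<le> K" using False by (metis of_int_0_less_iff of_int_1_le_iff less_le
        int_one_le_iff_zero_less)
    have Kn: "0 < K * real n" using K1 n_pos by simp
    have "(1 - \<mu>) ^ t \<le> exp (- \<mu>) ^ t"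
      using rho_nonneg exp_ge_add_one_self[of "- \<mu>"] by (intro power_mono) auto
    also have "\<dots> = exp (- (real t * \<mu>))" by (simp add: exp_of_nat_mult[symmetric])
    also have "\<dots> \<le> exp (- ln (K * real n))" using t \<mu>0 by (simp add: K_def field_simps)
    also have "\<dots> = 1 / (K * real n)" using Kn by (simp add: exp_minus inverse_eq_divide)
    finally have "(1 - \<mu>) ^ t * (sqrt (real n) * K) \<le> 1 / (K * real n) * (sqrt (real n) * K)"
      using K1 by (intro mult_right_mono) auto
    also have "\<dots> = sqrt (real n) / real n" using K1 by simp
    also have "\<dots> \<le> 1" using n_pos by (simp add: real_le_lsqrt power2_eq_square)
    finally show ?thesis .
  qed simp
  have W: "\<bar>rest (t - k) u - indev (t - k - 1) u\<bar> \<le> W" if "u < n" "k < t" for u k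
  proof -
    have "1 \<le> (1 + c)\<^sup>2" using c_nonneg by simp
    then have "\<delta> * real d \<le> (1 + c)\<^sup>2 * (\<delta> * real d)"
      using mult_right_mono[of 1 "(1 + c)\<^sup>2" "\<delta> * real d"] \<delta>_nonneg by simp
    moreover have "\<bar>rest (t - k) u\<bar> \<le> (1 + c)\<^sup>2 * real d" using rest_le[of "t - k" u] that by simp
    moreover have "\<bar>indev (t - k - 1) u\<bar> \<le> \<delta> * real d" using that by (intro indev_le)
    moreover have "W = (1 + c)\<^sup>2 * real d + (1 + c)\<^sup>2 * (\<delta> * real d)" by (simp add: W_def algebra_simps)
    ultimately show ?thesis by linarith
  qed
  have W0: "0 \<le> W" using \<delta>_nonneg by (simp add: W_def)
  define B where "B = (\<delta> + 1) * real d * (1 + (1 + c)\<^sup>2 * S)"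
  have dev_m: "\<bar>y (t + 1) u - m\<bar> \<le> B" if u: "u < n" for u
  proof -
    have "y (t + 1) u = (walk ^^ t) (y 1) u + indev t u
        + (\<Sum>k<t. (walk ^^ k) (lap (\<lambda>v. rest (t - k) v - indev (t - k - 1) v)) u)"
    proof (rule recurrence_solution[OF _ _ u])
      show "y (t + 1) v = walk (y t) v + lap (rest t) v + (indev t v - indev (t - 1) v)"
        if "1 \<le> t" "v < n" for t v
        using load_recurrence[OF that] by (simp add: y_def[abs_def])
      show "indev 0 v = 0" for v by (simp add: indev_def dev_def cumulative_flow_def)
    qed
    moreover have "\<bar>(walk ^^ t) (y 1) u - m\<bar> \<le> 1"
    proof -
      have "(walk ^^ t) (y 1) u - m = (walk ^^ t) (\<lambda>v. y 1 v - m) u"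
        using u by (simp add: walk_pow_diff walk_pow_const)
      moreover have "\<bar>(walk ^^ t) (\<lambda>v. y 1 v - m) u\<bar> \<le> (1 - \<mu>) ^ t * (sqrt (real n) * K)"
        using yK n_pos by (intro sup_contraction[OF _ _ u]) (auto simp: m_def sum_subtractf)
      ultimately show ?thesis using decay by simp
    qed
    moreover have "\<bar>indev t u\<bar> \<le> \<delta> * real d" by (rule indev_le[OF u])
    moreover have "\<bar>\<Sum>k<t. (walk ^^ k) (lap (\<lambda>v. rest (t - k) v - indev (t - k - 1) v)) u\<bar> \<le> W * S"
    proof -
      have "\<bar>\<Sum>k<t. (walk ^^ k) (lap (\<lambda>v. rest (t - k) v - indev (t - k - 1) v)) u\<bar> \<le> (\<Sum>k<t. W * drift u k)"
        using W by (intro order_trans[OF sum_abs] sum_mono walk_pow_lap_le_drift[OF u]) auto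
      also have "\<dots> \<le> W * S" unfolding sum_distrib_left[symmetric] using S[OF u] W0 by (intro mult_left_mono) auto
      finally show ?thesis .
    qed
    ultimately have "\<bar>y (t + 1) u - m\<bar> \<le> 1 + \<delta> * real d + W * S" by linarith
    \<comment> \<open>The leftover 1 from the initial imbalance is absorbed by
      \<open>d\<close>.\<close>
    also have "\<dots> \<le> real d + \<delta> * real d + W * S" using d_pos by simp
    also have "\<dots> = B" by (simp add: B_def W_def algebra_simps)
    finally show ?thesis .
  qed
  have ne: "finite (x (t + 1) ` {..<n})" "x (t + 1) ` {..<n} \<noteq> {}" using n_pos by auto
  obtain u where u: "u < n" "Max (x (t + 1) ` {..<n}) = x (t + 1) u" using Max_in[OF ne] by auto
  obtain v where v: "v < n" "Min (x (t + 1) ` {..<n}) = x (t + 1) v" using Min_in[OF ne] by auto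
  have "discrepancy n (x (t + 1)) = (y (t + 1) u - m) - (y (t + 1) v - m)"
    by (simp only: discrepancy_def u v y_def)
  also have "\<dots> \<le> 2 * B" using dev_m[OF u(1)] dev_m[OF v(1)] by linarith
  finally show ?thesis by (simp only: B_def)
qed

end

section \<open>Choice of constants and the three discrepancy bounds\<close>

theorem theorem1:
  fixes c :: real
  shows "\<exists>a>0. \<exists>b>0. \<forall>(n::nat) (d::nat) (dl::nat) (E :: (nat \<times> nat) set) (\<delta>::real)
            (x :: nat \<Rightarrow> nat \<Rightarrow> nat) (f :: nat \<Rightarrow> edge \<Rightarrow> nat) (K::real) (\<mu>::real) (\<mu>'::real).
     regular_graph n d E \<and> dl \<ge> 1 \<and> real dl \<le> c * real d \<and> \<delta> \<ge> 0 \<and>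
     balancing_run n E dl x f \<and> cumulatively_fair \<delta> n d E dl x f \<and>
     K = discrepancy n (x 1) \<and> \<mu> = gap n d E dl \<and> \<mu> > 0 \<and> \<mu>' = abs_gap n d E dl \<longrightarrow>
       (d + dl \<ge> 2 * d \<longrightarrow>
          (\<forall>t::nat. real t \<ge> a * (ln (K * real n) / \<mu>) \<longrightarrow>
             discrepancy n (x (t + 1)) \<le> b * ((\<delta> + 1) * real d * sqrt (ln (real n) / \<mu>)))) \<and>
       (d + dl \<ge> 2 * d \<longrightarrow>
          (\<forall>t::nat. real t \<ge> a * (ln (K * real n) / \<mu>) \<longrightarrow>
             discrepancy n (x (t + 1)) \<le> b * ((\<delta> + 1) * real d * sqrt (real n)))) \<and>
       (d + dl \<ge> d + 1 \<longrightarrow>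
          (\<forall>t::nat. real t \<ge> a * (ln (K * real n) / \<mu>') \<longrightarrow>
             discrepancy n (x (t + 1)) \<le> b * ((\<delta> + 1) * real d * (ln (real n) / \<mu>'))))"
proof -
  \<comment> \<open>\<open>c\<close> is arbitrary, so its absolute value is used to have a
    nonnegative factor; \<open>C\<close> then bounds the ratio of \<open>d + dl\<close> to
    \<open>d\<close>.\<close>
  define C where "C = 1 + \<bar>c\<bar>"
  define b where "b = 2 * (2 + 18 * C ^ 3)"
  have C1: "1 \<le> C" by (simp add: C_def)
  have b_pos: "0 < b" using C1 by (simp add: b_def add_pos_nonneg)
  have main:
    "(d + dl \<ge> 2 * d \<longrightarrow>
          (\<forall>t::nat. real t \<ge> 1 * (ln (K * real n) / \<mu>) \<longrightarrow>
             discrepancy n (x (t + 1)) \<le> b * ((\<delta> + 1) * real d * sqrt (ln (real n) / \<mu>)))) \<and>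
     (d + dl \<ge> 2 * d \<longrightarrow>
          (\<forall>t::nat. real t \<ge> 1 * (ln (K * real n) / \<mu>) \<longrightarrow>
             discrepancy n (x (t + 1)) \<le> b * ((\<delta> + 1) * real d * sqrt (real n)))) \<and>
     (d + dl \<ge> d + 1 \<longrightarrow>
          (\<forall>t::nat. real t \<ge> 1 * (ln (K * real n) / \<mu>') \<longrightarrow>
             discrepancy n (x (t + 1)) \<le> b * ((\<delta> + 1) * real d * (ln (real n) / \<mu>'))))"
    if asm: "regular_graph n d E \<and> dl \<ge> 1 \<and> real dl \<le> c * real d \<and> \<delta> \<ge> 0 \<and>
     balancing_run n E dl x f \<and> cumulatively_fair \<delta> n d E dl x f \<and>
     K = discrepancy n (x 1) \<and> \<mu> = gap n d E dl \<and> \<mu> > 0 \<and> \<mu>' = abs_gap n d E dl"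
    for n d dl E \<delta> x f K \<mu> \<mu>'
  proof -
    \<comment> \<open>With \<open>d = 0\<close> the bound on \<open>dl\<close> would contradict
      \<open>dl \<ge> 1\<close>.\<close>
    have "d \<noteq> 0" using asm by (cases "d = 0") auto
    moreover have "real dl \<le> \<bar>c\<bar> * real d"
      using asm mult_right_mono[OF abs_ge_self[of c], of "real d"] by linarith
    ultimately interpret fair_run n d E dl \<delta> x f "\<bar>c\<bar>"
      using asm by unfold_locales auto
    have gap_pos: "0 < gap n d E dl" using asm by simp
    note gaps = contracting_gaps[OF gap_pos]
    have \<mu>: "\<mu> = gap n d E dl" "\<mu>' = abs_gap n d E dl" and K: "K = discrepancy n (x 1)" using asm by auto
    \<comment> \<open>One estimate serves all three cases, with \<open>s\<close> the target
      quantity: \<open>18 * C\<close> dominates the drift constants 8, 16 and 18 (1 + |c|), and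
      \<open>1 \<le> 2 * s\<close> absorbs the summand 1. This is where the 2 and the 18 in
      \<open>b\<close> come from.\<close>
    have bound: "discrepancy n (x (t + 1)) \<le> b * ((\<delta> + 1) * real d * s)"
      if con: "contracting_kernel n p (1 - \<nu>)" and t: "1 * (ln (K * real n) / \<nu>) \<le> real t"
        and S: "\<And>u. u < n \<Longrightarrow> (\<Sum>k<t. drift u k) \<le> 18 * C * s" and s: "1 \<le> 2 * s" for t \<nu> s
    proof -
      have "ln (discrepancy n (x 1) * real n) / \<nu> \<le> real t" using t by (simp add: K)
      from discrepancy_le[OF con this S]
      have "discrepancy n (x (t + 1)) \<le> 2 * ((\<delta> + 1) * real d * (1 + C\<^sup>2 * (18 * C * s)))"
        by (simp only: C_def)
      also have "\<dots> \<le> 2 * ((\<delta> + 1) * real d * ((2 + 18 * C ^ 3) * s))"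
        using s \<delta>_nonneg
        by (intro mult_left_mono) (simp_all add: algebra_simps power2_eq_square power3_eq_cube)
      finally show ?thesis by (simp add: b_def mult_ac)
    qed
    have half: "1 / 2 \<le> ln (real n) / \<nu>" if "contracting_kernel n p (1 - \<nu>)" "\<nu> \<le> 1" for \<nu>
      using sqrt_mult_power_le_half(3)[OF n_ge_2 _ that(2)] contracting_kernel.rho_less_1[OF that(1)] by simp
    have scale: "y \<le> C * y" if "0 \<le> y" for y using mult_right_mono[OF C1 that] by simp
    show ?thesis
    proof (intro conjI impI allI)
      fix t :: nat
      assume lz: "2 * d \<le> d + dl" and t: "1 * (ln (K * real n) / \<mu>) \<le> real t"
      have dl: "d \<le> dl" using lz by simp
      have con: "contracting_kernel n p (1 - \<mu>)" and \<mu>1: "\<mu> \<le> 1" using gaps(4,5)[OF dl] \<mu> by auto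
      show "discrepancy n (x (t + 1)) \<le> b * ((\<delta> + 1) * real d * sqrt (ln (real n) / \<mu>))"
      proof (rule bound[OF con t])
        have "sqrt (1 / 4) \<le> sqrt (ln (real n) / \<mu>)"
          using half[OF con \<mu>1] by (intro real_sqrt_le_mono) linarith
        then show s: "1 \<le> 2 * sqrt (ln (real n) / \<mu>)" by (simp add: real_sqrt_divide mult.commute)
        fix u assume u: "u < n"
        have "sqrt (ln (real n) / \<mu>) \<le> C * sqrt (ln (real n) / \<mu>)" using s by (intro scale) linarith
        then show "(\<Sum>k<t. drift u k) \<le> 18 * C * sqrt (ln (real n) / \<mu>)"
          using sum_drift_le_spectral(2)[OF con \<mu>1 u dl, of t] s by linarith
      qed
      show "discrepancy n (x (t + 1)) \<le> b * ((\<delta> + 1) * real d * sqrt (real n))"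
      proof (rule bound[OF con t])
        have "1 \<le> sqrt (real n)" using n_ge_2 by simp
        then show "1 \<le> 2 * sqrt (real n)" by linarith
        fix u assume "u < n"
        from sum_drift_le_sqrt_nodes[OF con dl c_nonneg dl_le this, of t]
        show "(\<Sum>k<t. drift u k) \<le> 18 * C * sqrt (real n)" by (simp add: C_def)
      qed
    next
      fix t :: nat
      assume t: "1 * (ln (K * real n) / \<mu>') \<le> real t"
      have con: "contracting_kernel n p (1 - \<mu>')" and \<mu>1: "\<mu>' \<le> 1" using gaps(2,3) \<mu> by auto
      show "discrepancy n (x (t + 1)) \<le> b * ((\<delta> + 1) * real d * (ln (real n) / \<mu>'))"
      proof (rule bound[OF con t])
        show s: "1 \<le> 2 * (ln (real n) / \<mu>')" using half[OF con \<mu>1] by linarith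
        fix u assume u: "u < n"
        have "(ln (real n) / \<mu>') \<le> C * (ln (real n) / \<mu>')" using s by (intro scale) linarith
        then show "(\<Sum>k<t. drift u k) \<le> 18 * C * (ln (real n) / \<mu>')"
          using sum_drift_le_spectral(1)[OF con \<mu>1 u, of t] s by linarith
      qed
    qed
  qed
  show ?thesis
    by (rule exI[of _ 1], rule conjI, simp, rule exI[of _ b], rule conjI, rule b_pos,
        intro allI, rule impI, rule main)
qed

end
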